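(* Let $T$ be an $m$-linear operator acting on $m$-tuples of functions on $\mathbb{R}^n$. Fix $1<p_j<\infty$, $1<s_j<\infty$, and $\theta_j>0$, $1\le j\le m$. Let $1<p<\infty$ be such that $\frac1p=\sum_{j=1}^m\frac1{p_j}$, and suppose that there exist increasing functions $\phi_j:[1,\infty)\to[0,\infty)$ such that for all $\mathbf{w}=(w_1,\dots,w_m)$ satisfying $w_j^{\theta_j}\in A_{s_j}$, $1\le j\le m$, we have $$\|T\mathbf{f}\|_{L^p(\prod_{j=1}^mw_j^p)}\le\prod_{j=1}^m\phi_j\big([w_j^{\theta_j}]_{A_{s_j}}\big)\,\|f_j\|_{L^{p_j}(w_j^{p_j})}.$$ Then, for all $\mathbf{b}=(b_1,\dots,b_m)\in\mathcal{BMO}^m$, for each multi-index $\alpha$ and each vector weight $\mathbf{w}=(w_1,\dots,w_m)$ such that for all $1\le j\le m$, $w_j^{\eta_j\theta_j}\in A_{s_j}$ with some $1<\eta_j<\infty$, we have $$\|[T,\mathbf{b}]_\alpha\mathbf{f}\|_{L^p(\prod_{j=1}^mw_j^p)}\le\alpha!\prod_{j=1}^m\frac1{\delta_j^{\alpha_j}}\,\phi_j\Big(4^{\theta_j\delta_j}\,[w_j^{\theta_j\eta_j}]_{A_{s_j}}^{1/\eta_j}\Big)\,\|b_j\|_{\mathcal{BMO}}^{\alpha_j}\,\|f_j\|_{L^{p_j}(w_j^{p_j})},$$ where $\delta_j=\frac{\min\{1,s_j-1\}}{\eta_j'\,\theta_j}$ and $\frac1{\eta_j}+\frac1{\eta_j'}=1$,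 $1\le j\le m$.
   Context: A weight is a non-negative locally integrable function on $\mathbb{R}^n$; $\|f\|_{L^p(w)}=(\int_{\mathbb{R}^n}|f|^p w\,dx)^{1/p}$. $Q$ denotes cubes in $\mathbb{R}^n$ with sides parallel to the axes and $f_Q=\frac1{|Q|}\int_Q f\,dx$. For $1<s<\infty$, $w\in A_s$ means $$[w]_{A_s}:=\sup_Q\Big(\frac1{|Q|}\int_Q w\,dx\Big)\Big(\frac1{|Q|}\int_Q w^{1-s'}\,dx\Big)^{s-1}<\infty,\qquad\tfrac1s+\tfrac1{s'}=1.$$ $\|f\|_{\exp L,Q}:=\inf\{\lambda>0:\ \frac1{|Q|}\int_Q e^{|f|/\lambda}\,dx\le 2\}$, and $\mathcal{BMO}$ is the space of locally integrable $b$ with $\|b\|_{\mathcal{BMO}}:=\sup_Q\|b-b_Q\|_{\exp L,Q}<\infty$. For $\mathbf{f}=(f_1,\dots,f_m)$ and $\mathbf{b}=(b_1,\dots,b_m)$ measurable, commutators are defined (whenever they make sense) by $$[T,\mathbf{b}]_{e_j}(\mathbf{f})=b_jT(f_1,\dots,f_j,\dots,f_m)-T(f_1,\dots,b_jf_j,\dots,f_m),$$ $[T,\mathbf{b}]_{ke_j}=[\cdots[[T,\mathbf{b}]_{e_j},\mathbf{b}]_{e_j}\cdots,\mathbf{b}]_{e_j}$ ($k$ times), and for a multi-index $\alpha=(\alpha_1,\dots,\alpha_m)\in(\mathbb{N}\cup\{0\})^m$, $$[T,\mathbf{b}]_\alpha=[\cdots[[T,\mathbf{b}]_{\alpha_1e_1},\mathbf{b}]_{\alpha_2e_2}\cdots,\mathbf{b}]_{\alpha_me_m}.$$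 As usual $\alpha!=\alpha_1!\cdots\alpha_m!$. *)

theory Defs
  imports "HOL-Analysis.Analysis" "HOL-Library.FuncSet"
begin

section \<open>Cubes, averages and locally integrable functions\<close>

(* Closed cubes; the boundary is a null set, so open cubes would give the same notions. *)
definition cubes :: "(real ^ 'n) set set" where
  "cubes = {cbox a (a + l *\<^sub>R One) | a l. l > 0}"

definition nn_avg :: "(real ^ 'n) set \<Rightarrow> (real ^ 'n \<Rightarrow> ennreal) \<Rightarrow> ennreal" where
  "nn_avg Q g = (\<integral>\<^sup>+ x \<in> Q. g x \<partial>lebesgue) / emeasure lebesgue Q"

definition avg :: "(real ^ 'n) set \<Rightarrow> (real ^ 'n \<Rightarrow> complex) \<Rightarrow> complex" where
  "avg Q f = (LINT x:Q|lebesgue. f x) /\<^sub>R measure lebesgue Q"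

definition locally_integrable ::
    "(real ^ 'n \<Rightarrow> 'b :: {banach, second_countable_topology}) \<Rightarrow> bool" where
  "locally_integrable f \<longleftrightarrow> (\<forall>K. compact K \<longrightarrow> set_integrable lebesgue K f)"

section \<open>Weights and weighted Lebesgue spaces\<close>

definition weight :: "(real ^ 'n \<Rightarrow> real) \<Rightarrow> bool" where
  "weight w \<longleftrightarrow> (\<forall>x. 0 \<le> w x) \<and> locally_integrable w"

definition conj_exp :: "real \<Rightarrow> real" where
  "conj_exp s = 1 / (1 - 1 / s)"

(* Only used for a > 0. *)
definition ennpowr :: "ennreal \<Rightarrow> real \<Rightarrow> ennreal" where
  "ennpowr x a = (if x = top then top else ennreal (enn2real x powr a))"

(* w^(1-s') is written as the ennreal inverse of w^(s'-1), so that it is infinite where w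
   vanishes (whereas 0 powr (1-s') = 0 in HOL). *)
definition Ap_const :: "real \<Rightarrow> (real ^ 'n \<Rightarrow> real) \<Rightarrow> ennreal" where
  "Ap_const s w =
    (SUP Q \<in> cubes.
       nn_avg Q (\<lambda>x. ennreal (w x)) *
       ennpowr (nn_avg Q (\<lambda>x. inverse (ennreal (w x powr (conj_exp s - 1))))) (s - 1))"

(* The weight vanishing almost everywhere is excluded: it would get the constant 0 from the
   convention 0 * top = 0. Every other weight that vanishes on a set of positive measure has
   infinite constant. *)
definition Ap_weight :: "real \<Rightarrow> (real ^ 'n \<Rightarrow> real) \<Rightarrow> bool" where
  "Ap_weight s w \<longleftrightarrow> weight w \<and> \<not> (AE x in lebesgue. w x = 0) \<and> Ap_const s w < top"

definition Lp_norm :: "real \<Rightarrow> (real ^ 'n \<Rightarrow> real) \<Rightarrow> (real ^ 'n \<Rightarrow> complex) \<Rightarrow> ennreal" where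
  "Lp_norm p w f = ennpowr (\<integral>\<^sup>+ x. ennreal (norm (f x) powr p * w x) \<partial>lebesgue) (1 / p)"

definition Lp_space :: "real \<Rightarrow> (real ^ 'n \<Rightarrow> real) \<Rightarrow> (real ^ 'n \<Rightarrow> complex) set" where
  "Lp_space p w = {f \<in> borel_measurable lebesgue. Lp_norm p w f < top}"

section \<open>BMO\<close>

definition expL_norm :: "(real ^ 'n) set \<Rightarrow> (real ^ 'n \<Rightarrow> complex) \<Rightarrow> ennreal" where
  "expL_norm Q f =
    Inf {ennreal l | l. l > 0 \<and> nn_avg Q (\<lambda>x. ennreal (exp (norm (f x) / l))) \<le> 2}"

definition BMO_norm :: "(real ^ 'n \<Rightarrow> complex) \<Rightarrow> ennreal" where
  "BMO_norm b = (SUP Q \<in> cubes. expL_norm Q (\<lambda>x. b x - avg Q b))"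

definition BMO :: "(real ^ 'n \<Rightarrow> complex) set" where
  "BMO = {b. locally_integrable b \<and> BMO_norm b < top}"

section \<open>Multilinear operators and commutators\<close>

(* An m-tuple (f_1, ..., f_m) is an extensional function on the index set {1..m}. *)
type_synonym 'n mop = "(nat \<Rightarrow> real ^ 'n \<Rightarrow> complex) \<Rightarrow> real ^ 'n \<Rightarrow> complex"

(* T is m-linear on D 1 \<times> ... \<times> D m, the D j being complex vector spaces of measurable functions;
   T takes values in measurable functions modulo equality almost everywhere. *)
definition multilinear_operator ::
    "nat \<Rightarrow> (nat \<Rightarrow> (real ^ 'n \<Rightarrow> complex) set) \<Rightarrow> 'n mop \<Rightarrow> bool" where
  "multilinear_operator m D T \<longleftrightarrow>
    (\<forall>j\<in>{1..m}. D j \<subseteq> borel_measurable lebesgue \<and> (\<lambda>_. 0) \<in> D j \<and>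
       (\<forall>g\<in>D j. \<forall>h\<in>D j. \<forall>c. (\<lambda>x. c * g x + h x) \<in> D j)) \<and>
    (\<forall>f \<in> (\<Pi>\<^sub>E j\<in>{1..m}. D j). T f \<in> borel_measurable lebesgue \<and>
       (\<forall>j\<in>{1..m}. \<forall>g\<in>D j. \<forall>h\<in>D j. \<forall>c.
          AE x in lebesgue.
            T (f(j := (\<lambda>y. c * g y + h y))) x = c * T (f(j := g)) x + T (f(j := h)) x))"

definition commutator ::
    "(nat \<Rightarrow> real ^ 'n \<Rightarrow> complex) \<Rightarrow> nat \<Rightarrow> 'n mop \<Rightarrow> 'n mop" where
  "commutator b j T = (\<lambda>f x. b j x * T f x - T (f(j := (\<lambda>y. b j y * f j y))) x)"

(* The slots are processed in the order 1, ..., m, slot j being iterated \<alpha> j times. *)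
definition multi_commutator ::
    "nat \<Rightarrow> (nat \<Rightarrow> real ^ 'n \<Rightarrow> complex) \<Rightarrow> (nat \<Rightarrow> nat) \<Rightarrow> 'n mop \<Rightarrow> 'n mop" where
  "multi_commutator m b \<alpha> T = fold (\<lambda>j. commutator b j ^^ \<alpha> j) [1..<Suc m] T"

end

theory Submission
  imports Defs
begin

text \<open>For fixed \<open>f\<close>, the commutator \<open>[T, b]\<^sub>\<alpha> f\<close> is \<open>\<alpha>!\<close> times the Taylor coefficient of order
  \<open>\<alpha>\<close> at \<open>0\<close> of \<open>z \<mapsto> exp (z b) T (exp (- z b) f)\<close>. On a circle \<open>|z| = r\<close> this conjugated operator
  is bounded with the weight \<open>w exp (Re (z b))\<close>, whose \<open>A\<^sub>s\<close> constant is controlled by Hoelder's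
  inequality and the exponential integrability of \<open>b\<close> as long as \<open>r < \<delta> / ||b||\<close>; letting \<open>r\<close> tend to
  \<open>\<delta> / ||b||\<close> also covers \<open>||b|| = 0\<close>. Since \<open>T\<close> is linear only up to null sets, no vector-valued
  Cauchy integral is used: the mean over roots of unity isolates the Taylor coefficient exactly once
  the exponentials are replaced by Taylor polynomials, and the error of that replacement is small in
  the space with weight \<open>w exp (- R |b|)\<close>, \<open>r < R < \<delta> / ||b||\<close>. Slots are treated one after the
  other.\<close>

section \<open>Averages over cubes\<close>

text \<open>Hoelder's inequality spends the exponent 1/\<eta> on the unperturbed weight and leaves 1
  - 1/\<eta> = 1/\<eta>' for the exponential of the oscillation of b. The perturbation enters the
  first A_s average to the power \<theta> and the dual one to the power \<theta>/(s - 1); making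
  both fit is what produces \<open>min 1 (s - 1)\<close> in \<delta>. Each average leaves a power of
  the bound 2 on the exponential averages, and together they give the factor
  \<open>4 powr (\<theta> * \<delta>)\<close>. The obstacle in the discrete Cauchy formula is that
  returning from the small weight w exp (- R |b|) to w, with the factor exp (z b) still in front of
  the operator, costs exp (2 R |b|), which is unbounded. The error is therefore estimated only where
  |b| is at most N; there it tends to 0 with the degree of the Taylor polynomials, while the main
  term has a bound independent of N, and Fatou's lemma removes the cutoff. To keep the constant
  exact when the error is added, a convexity inequality with a free parameter is used, whose factor
  on the main term can be made as close to 1 as desired.\<close>

lemma ennpowr_top [simp]: "ennpowr top a = top"
  by (simp add: ennpowr_def)

lemma ennpowr_ennreal: "0 \<le> x \<Longrightarrow> ennpowr (ennreal x) a = ennreal (x powr a)"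
  by (simp add: ennpowr_def)

lemma ennpowr_0 [simp]: "ennpowr 0 a = 0"
  by (simp add: ennpowr_def)

lemma ennpowr_eq_0_iff [simp]: "ennpowr x a = 0 \<longleftrightarrow> x = 0"
  by (cases x) (auto simp: ennpowr_ennreal simp flip: ennreal_0)

lemma ennpowr_eq_top_iff [simp]: "ennpowr x a = top \<longleftrightarrow> x = top"
  by (simp add: ennpowr_def)

lemma ennpowr_less_top_iff [simp]: "ennpowr x a < top \<longleftrightarrow> x < top"
  by (simp add: less_top[symmetric])

lemma ennpowr_mono: "x \<le> y \<Longrightarrow> 0 \<le> a \<Longrightarrow> ennpowr x a \<le> ennpowr y a"
  by (cases x; cases y) (auto simp: ennpowr_ennreal top_unique intro: powr_mono2)

lemma ennpowr_ennpowr: "ennpowr (ennpowr x a) b = ennpowr x (a * b)"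
  by (cases x) (auto simp: ennpowr_ennreal powr_powr)

lemma ennpowr_1 [simp]: "ennpowr x 1 = x"
  by (cases x) (auto simp: ennpowr_ennreal)

lemma ennpowr_mult: "ennpowr (x * y) a = ennpowr x a * ennpowr y a"
proof (cases "x = 0 \<or> y = 0")
  case False
  show ?thesis
  proof (cases "x = top \<or> y = top")
    case True
    with False show ?thesis by (auto simp: ennreal_mult_top ennreal_top_mult)
  next
    case F: False
    then obtain a b where "0 \<le> a" "x = ennreal a" "0 \<le> b" "y = ennreal b"
      by (cases x; cases y) auto
    then show ?thesis by (simp add: ennpowr_ennreal powr_mult flip: ennreal_mult)
  qed
qed auto

lemma ennreal_pos_cases [case_names zero top real]:
  fixes x y :: ennreal
  obtains "x = 0 \<or> y = 0" | "x \<noteq> 0" "y \<noteq> 0" "x = top \<or> y = top"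
    | r t where "0 < r" "0 < t" "x = ennreal r" "y = ennreal t"
proof (cases "x = 0 \<or> y = 0 \<or> x = top \<or> y = top")
  case False
  then have "x = ennreal (enn2real x)" "y = ennreal (enn2real y)" "0 < enn2real x" "0 < enn2real y"
    by (auto simp: enn2real_positive_iff less_top zero_less_iff_neq_zero)
  with that(3) show ?thesis by blast
qed (use that in blast)

lemma ennpowr_inverse: "0 < x \<Longrightarrow> ennpowr (inverse (ennreal x)) a = inverse (ennreal (x powr a))"
  by (simp add: inverse_ennreal ennpowr_ennreal inverse_powr)

lemma borel_measurable_ennpowr [measurable]: "(\<lambda>x. ennpowr x a) \<in> borel_measurable borel"
  unfolding ennpowr_def by measurable

lemma measurable_ennpowr [measurable (raw)]:
  "g \<in> borel_measurable M \<Longrightarrow> (\<lambda>x. ennpowr (g x) a) \<in> borel_measurable M"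
  by measurable

text \<open>Young's inequality is applied twice: with the exponents normalized by
  \<open>?c = a + b\<close>, and then to the power \<open>?c\<close> of the outcome against the
  constant 1 with weight \<open>1 - ?c\<close>. That constant is the source of the term
  \<open>1 - a - b\<close>.\<close>

lemma sub_weighted_amgm:
  fixes x y a b :: real
  assumes "0 < x" "0 < y" "0 < a" "0 < b" "a + b \<le> 1"
  shows "x powr a * y powr b \<le> a * x + b * y + (1 - a - b)"
proof -
  let ?c = "a + b"
  have dist: "d * (a / d * x + b / d * y) = a * x + b * y" if "d \<noteq> 0" for d
    using that by (simp add: field_simps)
  have 1: "x powr (a/?c) * y powr (b/?c) \<le> a/?c * x + b/?c * y" (is "?l \<le> ?r")
    by (rule Youngs_inequality_0) (use assms in \<open>auto simp flip: add_divide_distrib\<close>)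
  have r: "?r > 0" using assms by (intro add_pos_pos) auto
  have "?l powr ?c \<le> ?r powr ?c" using 1 assms by (intro powr_mono2) auto
  also have "\<dots> = ?r powr ?c * 1 powr (1 - ?c)" by simp
  also have "\<dots> \<le> ?c * ?r + (1 - ?c) * 1"
    by (rule Youngs_inequality_0) (use assms r in auto)
  also have "?c * ?r = a * x + b * y"
    using dist[of ?c] assms by simp
  also have "?l powr ?c = x powr a * y powr b"
    using assms by (simp add: powr_mult powr_powr)
  finally show ?thesis by simp
qed

lemma cubes_emeasure:
  assumes "Q \<in> (cubes :: (real^'n) set set)"
  shows "0 < emeasure lebesgue Q" "emeasure lebesgue Q < top" "Q \<in> sets lebesgue" "compact Q"
proof -
  obtain a :: "real^'n" and l where Q: "Q = cbox a (a + l *\<^sub>R One)" "l > 0"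
    using assms by (auto simp: cubes_def)
  have "\<forall>i\<in>Basis. a \<bullet> i \<le> (a + l *\<^sub>R One) \<bullet> i"
    using Q by (simp add: inner_add_left)
  then have m: "emeasure lebesgue Q = ennreal (l ^ CARD('n))"
    unfolding Q by (simp add: emeasure_lborel_cbox_eq inner_add_left)
  show "0 < emeasure lebesgue Q" unfolding m using Q by simp
  show "emeasure lebesgue Q < top" unfolding m by simp
  show "Q \<in> sets lebesgue" "compact Q" using Q by auto
qed

lemma nn_avg_mono_AE:
  assumes "AE x in lebesgue. x \<in> Q \<longrightarrow> g x \<le> h x"
  shows "nn_avg Q g \<le> nn_avg Q h"
  unfolding nn_avg_def
  by (intro divide_right_mono_ennreal nn_integral_mono_AE)
     (use assms in \<open>auto split: split_indicator elim!: eventually_mono\<close>)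

lemma nn_avg_mono: "(\<And>x. x \<in> Q \<Longrightarrow> g x \<le> h x) \<Longrightarrow> nn_avg Q g \<le> nn_avg Q h"
  by (intro nn_avg_mono_AE) auto

lemma nn_avg_cmult:
  assumes "Q \<in> cubes" "g \<in> borel_measurable lebesgue"
  shows "nn_avg Q (\<lambda>x. c * g x) = c * nn_avg Q g"
  using assms cubes_emeasure(3)[OF assms(1)] unfolding nn_avg_def
  by (simp add: nn_integral_cmult ennreal_times_divide mult.assoc)

lemma nn_avg_add:
  assumes "Q \<in> cubes" "g \<in> borel_measurable lebesgue" "h \<in> borel_measurable lebesgue"
  shows "nn_avg Q (\<lambda>x. g x + h x) = nn_avg Q g + nn_avg Q h"
  using assms cubes_emeasure(3)[OF assms(1)] unfolding nn_avg_def
  by (simp add: nn_integral_add distrib_right add_divide_distrib_ennreal)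

lemma nn_avg_const:
  assumes "Q \<in> cubes" shows "nn_avg Q (\<lambda>x. c) = c"
  using cubes_emeasure[OF assms] unfolding nn_avg_def
  by (simp add: nn_integral_cmult_indicator ennreal_mult_divide_eq)

lemma nn_avg_eq_0:
  assumes "Q \<in> cubes" "g \<in> borel_measurable lebesgue" "nn_avg Q g = 0"
  shows "AE x in lebesgue. x \<in> Q \<longrightarrow> g x = 0"
proof -
  have "(\<integral>\<^sup>+ x \<in> Q. g x \<partial>lebesgue) = 0"
    using assms(3) cubes_emeasure(2)[OF assms(1)] unfolding nn_avg_def
    by (auto simp: ennreal_divide_eq_0_iff)
  then have "AE x in lebesgue. g x * indicator Q x = 0"
    using assms(2) cubes_emeasure(3)[OF assms(1)] by (subst (asm) nn_integral_0_iff_AE) auto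
  then show ?thesis by (auto elim!: eventually_mono split: split_indicator_asm)
qed

text \<open>Exponents with \<^term>\<open>a + b < 1\<close> are allowed because averages are taken over a probability
  measure; the inequality thus contains Jensen's inequality for powers.\<close>

lemma nn_avg_Holder:
  assumes Q: "Q \<in> cubes"
    and F[measurable]: "F \<in> borel_measurable lebesgue" and G[measurable]: "G \<in> borel_measurable lebesgue"
    and ab: "0 < a" "0 < b" "a + b \<le> 1"
  shows "nn_avg Q (\<lambda>x. ennpowr (F x) a * ennpowr (G x) b)
          \<le> ennpowr (nn_avg Q F) a * ennpowr (nn_avg Q G) b"
proof -
  let ?A = "nn_avg Q F" and ?B = "nn_avg Q G"
  show ?thesis
  proof (cases ?A ?B rule: ennreal_pos_cases)
    \<comment> \<open>The integrand vanishes almost everywhere on \<open>Q\<close>, even where the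
      other factor is infinite, because 0 * top = 0.\<close>
    case zero
    then have "AE x in lebesgue. x \<in> Q \<longrightarrow> ennpowr (F x) a * ennpowr (G x) b = 0"
      using nn_avg_eq_0[OF Q F] nn_avg_eq_0[OF Q G] by (auto elim!: eventually_mono)
    then have "nn_avg Q (\<lambda>x. ennpowr (F x) a * ennpowr (G x) b) \<le> nn_avg Q (\<lambda>x. 0)"
      by (intro nn_avg_mono_AE) (auto elim!: eventually_mono)
    then show ?thesis by (simp add: nn_avg_const[OF Q])
  next
    case top
    then have "ennpowr ?A a * ennpowr ?B b = top"
      by (simp add: ennreal_mult_eq_top_iff)
    then show ?thesis by simp
  next
    case 4: (real A B)
    define c where "c = ennreal (A powr a * B powr b)"
    \<comment> \<open>This is Young's inequality for \<open>F x / A\<close> and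
      \<open>G x / B\<close>. Averaging the bracket on the right gives a + b + (1 - a - b) = 1, so
      exactly the constant \<open>c\<close> remains.\<close>
    have pt: "ennpowr (F x) a * ennpowr (G x) b
        \<le> c * ((ennreal (a / A) * F x + ennreal (b / B) * G x) + ennreal (1 - a - b))" for x
    proof -
      show ?thesis
      proof (cases "F x" "G x" rule: ennreal_pos_cases)
        case zero then show ?thesis by auto
      next
        case 2: top
        have "c * ((ennreal (a / A) * F x + ennreal (b / B) * G x) + ennreal (1 - a - b)) = top"
          using 2 4 ab by (auto simp: c_def ennreal_mult_eq_top_iff ennreal_eq_0_iff divide_le_0_iff mult_le_0_iff)
        then show ?thesis by simp
      next
        case 3: (real r t)
        have "(r / A) powr a * (t / B) powr b \<le> a * (r / A) + b * (t / B) + (1 - a - b)"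
          using 3 4 ab by (intro sub_weighted_amgm) auto
        then have "A powr a * B powr b * ((r / A) powr a * (t / B) powr b)
            \<le> A powr a * B powr b * (a * (r / A) + b * (t / B) + (1 - a - b))"
          by (intro mult_left_mono) auto
        moreover have "A powr a * B powr b * ((r / A) powr a * (t / B) powr b) = r powr a * t powr b"
          using 3 4 by (simp add: powr_divide)
        ultimately have "r powr a * t powr b
            \<le> A powr a * B powr b * (a / A * r + b / B * t + (1 - a - b))" by simp
        then have "ennreal (r powr a * t powr b)
            \<le> ennreal (A powr a * B powr b * (a / A * r + b / B * t + (1 - a - b)))"
          by (rule ennreal_leI)
        also have "\<dots> = c * ((ennreal (a / A) * F x + ennreal (b / B) * G x) + ennreal (1 - a - b))"
          unfolding c_def using 3 4 ab
          by (simp flip: ennreal_mult ennreal_plus)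
        finally show ?thesis using 3 by (simp add: ennpowr_ennreal ennreal_mult)
      qed
    qed
    have "nn_avg Q (\<lambda>x. ennpowr (F x) a * ennpowr (G x) b)
       \<le> nn_avg Q (\<lambda>x. c * ((ennreal (a / A) * F x + ennreal (b / B) * G x) + ennreal (1 - a - b)))"
      by (rule nn_avg_mono) (rule pt)
    also have "\<dots> = c * ((ennreal (a / A) * ?A + ennreal (b / B) * ?B) + ennreal (1 - a - b))"
      by (simp add: nn_avg_cmult[OF Q] nn_avg_add[OF Q] nn_avg_const[OF Q])
    also have "(ennreal (a / A) * ?A + ennreal (b / B) * ?B) + ennreal (1 - a - b) = 1"
      using 4 ab by (simp flip: ennreal_mult ennreal_plus ennreal_1)
    finally show ?thesis using 4 by (simp add: c_def ennpowr_ennreal ennreal_mult)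
  qed
qed

section \<open>Muckenhoupt weights under exponential perturbation\<close>

lemma locally_integrable_measurable:
  assumes "locally_integrable f"
  shows "f \<in> borel_measurable lebesgue"
proof (rule borel_measurable_LIMSEQ_metric)
  show "(\<lambda>x. indicator (cball 0 (real n)) x *\<^sub>R f x) \<in> borel_measurable lebesgue" for n
    using assms unfolding locally_integrable_def set_integrable_def
    by (intro borel_measurable_integrable) (simp only: compact_cball)
  show "(\<lambda>n. indicator (cball 0 (real n)) x *\<^sub>R f x) \<longlonglongrightarrow> f x" for x
  proof (rule tendsto_eventually)
    obtain n0 where "norm x \<le> real n0" using real_arch_simple by blast
    then show "\<forall>\<^sub>F n in sequentially. indicator (cball 0 (real n)) x *\<^sub>R f x = f x"
      by (intro eventually_sequentiallyI[of n0]) (auto simp: indicator_def)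
  qed
qed

text \<open>Written as corner plus side length to match the shape required by \<open>cubes\<close>.
  As \<open>B\<close> grows, these cubes exhaust the space.\<close>

definition ccube :: "real \<Rightarrow> (real^'n) set" where
  "ccube B = cbox (- B *\<^sub>R One) (- B *\<^sub>R One + (2 * B) *\<^sub>R One)"

lemma ccube_cubes: "0 < B \<Longrightarrow> ccube B \<in> cubes"
  unfolding cubes_def ccube_def mem_Collect_eq
  by (intro exI[of _ "- B *\<^sub>R One"] exI[of _ "2 * B"]) simp

lemma mem_ccube: "norm (x :: real^'n) \<le> B \<Longrightarrow> x \<in> ccube B"
  unfolding ccube_def mem_box
proof
  fix i :: "real^'n" assume "norm x \<le> B" "i \<in> Basis"
  then have "\<bar>x \<bullet> i\<bar> \<le> B" using Basis_le_norm[of i x] by linarith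
  then show "(- B *\<^sub>R One) \<bullet> i \<le> x \<bullet> i \<and> x \<bullet> i \<le> (- B *\<^sub>R One + (2 * B) *\<^sub>R One) \<bullet> i"
    using \<open>i \<in> Basis\<close> by (simp add: inner_diff_left abs_le_iff)
qed

lemma compact_subset_cube:
  assumes "compact K" shows "\<exists>Q\<in>cubes. K \<subseteq> Q"
proof -
  obtain B where "0 < B" "\<And>x. x \<in> K \<Longrightarrow> norm x \<le> B"
    using compact_imp_bounded[OF assms] unfolding bounded_pos by metis
  then show ?thesis
    by (intro bexI[of _ "ccube B"]) (auto simp: ccube_cubes mem_ccube)
qed

text \<open>Countably many centred cubes exhaust the space, so zero averages on all of them would
  make \<open>g\<close> vanish almost everywhere. The lemma serves to find a cube on which the
  product in \<open>Ap_const\<close> is not of the form 0 * top.\<close>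

lemma exists_cube_nn_avg_nonzero:
  assumes g: "g \<in> borel_measurable lebesgue" and nz: "\<not> (AE x in lebesgue. g x = 0)"
  shows "\<exists>Q\<in>cubes. nn_avg Q g \<noteq> 0"
proof (rule ccontr)
  assume "\<not> ?thesis"
  then have "AE x in lebesgue. x \<in> ccube (real (Suc n)) \<longrightarrow> g x = 0" for n
    by (intro nn_avg_eq_0[OF _ g]) (auto simp: ccube_cubes simp del: of_nat_Suc)
  then have "AE x in lebesgue. \<forall>n. x \<in> ccube (real (Suc n)) \<longrightarrow> g x = 0"
    by (subst AE_all_countable) auto
  then have "AE x in lebesgue. g x = 0"
  proof (rule eventually_mono)
    fix x assume *: "\<forall>n. x \<in> ccube (real (Suc n)) \<longrightarrow> g x = 0"
    obtain n where "norm x \<le> real n" using real_arch_simple by blast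
    then have "x \<in> ccube (real (Suc n))" by (intro mem_ccube) auto
    with * show "g x = 0" by blast
  qed
  with nz show False by blast
qed

lemma conj_exp_minus_1: "1 < s \<Longrightarrow> conj_exp s - 1 = 1 / (s - 1)"
  by (simp add: conj_exp_def field_simps)

text \<open>This is what places the constants in \<open>{1..}\<close>, where \<phi> is monotone. It
  is Hoelder's inequality for 1 = v^(1/s) * v^(-1/s) on a cube where \<open>v\<close> has nonzero
  average, raised to the power \<open>s\<close>.\<close>

lemma Ap_const_ge_1:
  assumes s: "1 < s" and v: "Ap_weight s v"
  shows "1 \<le> Ap_const s v"
proof -
  have v0: "0 \<le> v x" for x using v by (auto simp: Ap_weight_def weight_def)
  have e0: "ennreal (v x) = 0 \<longleftrightarrow> v x = 0" for x
    using v0[of x] by (metis antisym ennreal_eq_0_iff order_refl)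
  have vm[measurable]: "v \<in> borel_measurable lebesgue"
    using v by (auto simp: Ap_weight_def weight_def intro: locally_integrable_measurable)
  have "\<not> (AE x in lebesgue. ennreal (v x) = 0)"
    using v e0 by (simp add: Ap_weight_def)
  then obtain Q where Q: "Q \<in> cubes" "nn_avg Q (\<lambda>x. ennreal (v x)) \<noteq> 0"
    using exists_cube_nn_avg_nonzero[of "\<lambda>x. ennreal (v x)"] by auto
  define A where "A = nn_avg Q (\<lambda>x. ennreal (v x))"
  define G where "G = (\<lambda>x. inverse (ennreal (v x powr (conj_exp s - 1))))"
  define B where "B = nn_avg Q G"
  have G[measurable]: "G \<in> borel_measurable lebesgue" unfolding G_def by measurable
  have "1 \<le> A * ennpowr B (s - 1)"
  proof (cases "B = top")
    case True
    with Q(2) show ?thesis by (simp add: A_def ennreal_mult_top)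
  next
    case False
    \<comment> \<open>A finite dual average forces \<open>v\<close> to be positive almost everywhere
      on \<open>Q\<close>, so the factorization of 1 is legitimate there.\<close>
    have "AE x in lebesgue. G x * indicator Q x \<noteq> \<infinity>"
    proof (rule nn_integral_PInf_AE)
      show "(\<lambda>x. G x * indicator Q x) \<in> borel_measurable lebesgue"
        using cubes_emeasure(3)[OF Q(1)] by measurable
      show "(\<integral>\<^sup>+ x \<in> Q. G x \<partial>lebesgue) \<noteq> \<infinity>"
        using False cubes_emeasure(2)[OF Q(1)]
        by (auto simp: B_def nn_avg_def ennreal_top_divide less_top[symmetric])
    qed
    then have pos: "AE x in lebesgue. x \<in> Q \<longrightarrow> 0 < v x"
    proof (rule eventually_mono)
      fix x assume *: "G x * indicator Q x \<noteq> \<infinity>"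
      show "x \<in> Q \<longrightarrow> 0 < v x" using * v0[of x] by (cases "v x = 0") (auto simp: G_def)
    qed
    have "1 = nn_avg Q (\<lambda>x. 1 :: ennreal)" by (rule nn_avg_const[OF Q(1), symmetric])
    also have "\<dots> \<le> nn_avg Q (\<lambda>x. ennpowr (ennreal (v x)) (1/s) * ennpowr (G x) ((s-1)/s))"
    proof (rule nn_avg_mono_AE, use pos in eventually_elim, intro impI)
      fix x assume "x \<in> Q \<longrightarrow> 0 < v x" "x \<in> Q"
      then have vx: "0 < v x" by blast
      have "ennpowr (G x) ((s-1)/s) = inverse (ennreal (v x powr (1/s)))"
        unfolding G_def using vx s by (simp add: ennpowr_inverse conj_exp_minus_1 powr_powr)
      then show "1 \<le> ennpowr (ennreal (v x)) (1/s) * ennpowr (G x) ((s-1)/s)"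
        using vx by (simp add: ennpowr_ennreal inverse_ennreal flip: ennreal_mult ennreal_1)
    qed
    also have "\<dots> \<le> ennpowr A (1/s) * ennpowr B ((s-1)/s)"
      unfolding A_def B_def by (rule nn_avg_Holder[OF Q(1)]) (use s in \<open>auto simp: field_simps\<close>)
    finally have "1 \<le> ennpowr A (1/s) * ennpowr B ((s-1)/s)" .
    then have "ennpowr 1 s \<le> ennpowr (ennpowr A (1/s) * ennpowr B ((s-1)/s)) s"
      using s by (intro ennpowr_mono) auto
    then show ?thesis
      using s ennpowr_ennreal[of 1 s] by (simp add: ennpowr_mult ennpowr_ennpowr)
  qed
  also have "\<dots> \<le> Ap_const s v"
    unfolding Ap_const_def A_def B_def G_def by (rule SUP_upper) (rule Q)
  finally show ?thesis .
qed

text \<open>The infimum in \<open>expL_norm\<close> need not be attained, for instance when it is 0.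
  The strict inequality supplies an admissible \<open>l < N\<close>, and the exponential decreases
  when \<open>l\<close> is replaced by \<open>N\<close>.\<close>

lemma BMO_exp_avg_le:
  assumes "BMO_norm b < ennreal N" "Q \<in> cubes"
  shows "nn_avg Q (\<lambda>x. ennreal (exp (norm (b x - avg Q b) / N))) \<le> 2"
proof -
  have "expL_norm Q (\<lambda>x. b x - avg Q b) < ennreal N"
    using assms unfolding BMO_norm_def by (meson SUP_lessD)
  then obtain l where l: "l > 0" "ennreal l < ennreal N"
      "nn_avg Q (\<lambda>x. ennreal (exp (norm (b x - avg Q b) / l))) \<le> 2"
    unfolding expL_norm_def Inf_less_iff by blast
  then have "l < N" by (simp add: ennreal_less_iff)
  have "nn_avg Q (\<lambda>x. ennreal (exp (norm (b x - avg Q b) / N)))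
     \<le> nn_avg Q (\<lambda>x. ennreal (exp (norm (b x - avg Q b) / l)))"
    using \<open>l < N\<close> l(1) by (intro nn_avg_mono ennreal_leI) (auto intro!: divide_left_mono)
  with l(3) show ?thesis by (rule order_trans[rotated])
qed

lemma locally_integrableI_nn_avg:
  fixes v :: "real^'n \<Rightarrow> real"
  assumes v[measurable]: "v \<in> borel_measurable lebesgue" and "\<And>x. 0 \<le> v x"
    and fin: "\<And>Q. Q \<in> cubes \<Longrightarrow> nn_avg Q (\<lambda>x. ennreal (v x)) < top"
  shows "locally_integrable v"
  unfolding locally_integrable_def
proof (intro allI impI)
  fix K :: "(real^'n) set" assume "compact K"
  then obtain Q :: "(real^'n) set" where Q: "Q \<in> cubes" "K \<subseteq> Q"
    using compact_subset_cube[of K] by auto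
  have K: "K \<in> sets lebesgue" using \<open>compact K\<close> by (simp add: compact_imp_closed)
  have Qm[measurable]: "Q \<in> sets lebesgue" by (rule cubes_emeasure(3)[OF Q(1)])
  have fin': "(\<integral>\<^sup>+ x \<in> Q. ennreal (v x) \<partial>lebesgue) < top"
    using fin[OF Q(1)] cubes_emeasure(2)[OF Q(1)]
    by (auto simp: nn_avg_def ennreal_top_divide less_top[symmetric] split: if_splits)
  have "set_integrable lebesgue Q v"
    unfolding set_integrable_def
  proof (rule integrableI_bounded)
    have "(\<integral>\<^sup>+ x. ennreal (norm (indicator Q x *\<^sub>R v x)) \<partial>lebesgue) = (\<integral>\<^sup>+ x \<in> Q. ennreal (v x) \<partial>lebesgue)"
      by (intro nn_integral_cong) (use assms in \<open>auto split: split_indicator\<close>)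
    with fin' show "(\<integral>\<^sup>+ x. ennreal (norm (indicator Q x *\<^sub>R v x)) \<partial>lebesgue) < \<infinity>" by simp
  qed measurable
  then show "set_integrable lebesgue K v"
    by (rule set_integrable_subset) (use K Q in auto)
qed

text \<open>On a cube, \<^term>\<open>u\<close> is within \<^term>\<open>\<rho> * norm (b x - avg Q b)\<close> of a constant, and that
  constant cancels in the product of the two averages.\<close>

lemma Ap_perturb:
  fixes w :: "real^'n \<Rightarrow> real"
  assumes s: "1 < s" and \<theta>: "0 < \<theta>" and \<eta>: "1 < \<eta>" and w0: "\<And>x. 0 \<le> w x"
    and wm[measurable]: "w \<in> borel_measurable lebesgue"
    and Ap: "Ap_weight s (\<lambda>x. w x powr (\<eta> * \<theta>))"
    and b[measurable]: "b \<in> borel_measurable lebesgue" and N: "0 < N" "BMO_norm b < ennreal N"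
    and \<delta>: "\<delta> = min 1 (s - 1) / (conj_exp \<eta> * \<theta>)"
    and \<rho>: "\<rho> * N \<le> \<delta>"
    and um[measurable]: "u \<in> borel_measurable lebesgue"
    and u: "\<And>Q. Q \<in> cubes \<Longrightarrow> \<exists>c. \<forall>x. \<bar>u x - c\<bar> \<le> \<rho> * norm (b x - avg Q b)"
  defines "v \<equiv> \<lambda>x. (w x * exp (u x)) powr \<theta>"
  shows "Ap_weight s v"
    and "Ap_const s v \<le> ennreal (4 powr (\<theta> * \<delta>)) * ennpowr (Ap_const s (\<lambda>x. w x powr (\<eta> * \<theta>))) (1 / \<eta>)"
proof -
  define \<sigma> where "\<sigma> = 1 / (s - 1)"
  define \<mu> where "\<mu> = \<theta> * \<delta>"
  define A where "A = (\<lambda>Q. nn_avg Q (\<lambda>x. ennreal (w x powr (\<eta> * \<theta>))))"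
  define B where "B = (\<lambda>Q. nn_avg Q (\<lambda>x. inverse (ennreal ((w x powr (\<eta> * \<theta>)) powr \<sigma>))))"
  \<comment> \<open>The two entries of the minimum yield \<open>\<mu>1\<close> and
    \<open>\<mu>\<sigma>\<close>, the conditions under which \<open>nn_avg_Holder\<close> applies to
    the first and to the dual average.\<close>
  have \<mu>_eq: "\<mu> = min 1 (s - 1) * (1 - 1 / \<eta>)"
    using \<theta> \<eta> unfolding \<mu>_def \<delta> conj_exp_def by simp
  have \<eta>1: "0 < 1 - 1 / \<eta>" using \<eta> by simp
  have \<mu>0: "0 < \<mu>" using s \<eta>1 by (simp add: \<mu>_eq)
  have "\<mu> \<le> 1 * (1 - 1 / \<eta>)" unfolding \<mu>_eq using \<eta>1 by (intro mult_right_mono) auto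
  then have \<mu>1: "1 / \<eta> + \<mu> \<le> 1" by simp
  have \<sigma>0: "0 < \<sigma>" using s by (simp add: \<sigma>_def)
  have "\<mu> \<le> (s - 1) * (1 - 1 / \<eta>)" unfolding \<mu>_eq using \<eta>1 by (intro mult_right_mono) auto
  then have "\<mu> * \<sigma> \<le> 1 - 1 / \<eta>" using s by (simp add: \<sigma>_def field_simps)
  then have \<mu>\<sigma>: "1 / \<eta> + \<mu> * \<sigma> \<le> 1" by simp
  have \<sigma>s: "\<sigma> * (s - 1) = 1" using s by (simp add: \<sigma>_def)
  have v0: "0 \<le> v x" for x by (simp add: v_def)
  have vm[measurable]: "v \<in> borel_measurable lebesgue" unfolding v_def by measurable
  have main: "nn_avg Q (\<lambda>x. ennreal (v x))
        \<le> ennreal (exp (\<theta> * c)) * (ennpowr (A Q) (1/\<eta>) * ennpowr 2 \<mu>)" (is ?P1)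
    "nn_avg Q (\<lambda>x. inverse (ennreal (v x powr \<sigma>)))
        \<le> ennreal (exp (- \<theta> * \<sigma> * c)) * (ennpowr (B Q) (1/\<eta>) * ennpowr 2 (\<mu> * \<sigma>))" (is ?P2)
    if Q: "Q \<in> cubes" and c: "\<And>x. \<bar>u x - c\<bar> \<le> \<rho> * norm (b x - avg Q b)" for Q c
  proof -
    define X where "X = (\<lambda>x. norm (b x - avg Q b) / N)"
    have X[measurable]: "X \<in> borel_measurable lebesgue" unfolding X_def by measurable
    have X2: "nn_avg Q (\<lambda>x. ennreal (exp (X x))) \<le> 2"
      unfolding X_def by (rule BMO_exp_avg_le[OF N(2) Q])
    have uc: "\<theta> * \<bar>u x - c\<bar> \<le> \<mu> * X x" for x
    proof -
      have "\<bar>u x - c\<bar> \<le> (\<rho> * N) * X x" using c[of x] N by (simp add: X_def)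
      also have "\<dots> \<le> \<delta> * X x" using \<rho> N by (intro mult_right_mono) (auto simp: X_def)
      finally show ?thesis using \<theta> by (simp add: \<mu>_def)
    qed
    have "nn_avg Q (\<lambda>x. ennreal (v x)) \<le> nn_avg Q (\<lambda>x. ennreal (exp (\<theta> * c)) *
       (ennpowr (ennreal (w x powr (\<eta> * \<theta>))) (1/\<eta>) * ennpowr (ennreal (exp (X x))) \<mu>))"
    proof (rule nn_avg_mono)
      fix x
      have "v x = w x powr \<theta> * exp (\<theta> * u x)"
        using w0[of x] by (simp add: v_def powr_mult exp_powr_real mult.commute)
      also have "\<dots> \<le> w x powr \<theta> * exp (\<theta> * c + \<mu> * X x)"
      proof -
        have "\<theta> * u x - \<theta> * c \<le> \<theta> * \<bar>u x - c\<bar>"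
          using \<theta> by (simp flip: right_diff_distrib)
        then show ?thesis using uc[of x] by (intro mult_left_mono) auto
      qed
      finally have "v x \<le> exp (\<theta> * c) * (w x powr \<theta> * exp (\<mu> * X x))"
        by (simp add: exp_add mult_ac)
      then have "ennreal (v x) \<le> ennreal (exp (\<theta> * c) * (w x powr \<theta> * exp (\<mu> * X x)))"
        by (rule ennreal_leI)
      then show "ennreal (v x) \<le> ennreal (exp (\<theta> * c)) *
          (ennpowr (ennreal (w x powr (\<eta> * \<theta>))) (1/\<eta>) * ennpowr (ennreal (exp (X x))) \<mu>)"
        using \<eta> by (simp add: ennpowr_ennreal powr_powr exp_powr_real mult.commute flip: ennreal_mult)
    qed
    also have "\<dots> = ennreal (exp (\<theta> * c)) * nn_avg Q (\<lambda>x.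
       ennpowr (ennreal (w x powr (\<eta> * \<theta>))) (1/\<eta>) * ennpowr (ennreal (exp (X x))) \<mu>)"
      by (rule nn_avg_cmult[OF Q]) measurable
    also have "\<dots> \<le> ennreal (exp (\<theta> * c)) * (ennpowr (A Q) (1/\<eta>) *
        ennpowr (nn_avg Q (\<lambda>x. ennreal (exp (X x)))) \<mu>)"
      unfolding A_def by (intro mult_left_mono nn_avg_Holder[OF Q]) (use \<mu>1 \<mu>0 \<eta> in auto)
    also have "\<dots> \<le> ennreal (exp (\<theta> * c)) * (ennpowr (A Q) (1/\<eta>) * ennpowr 2 \<mu>)"
      using \<mu>0 X2 by (intro mult_left_mono ennpowr_mono) auto
    finally show ?P1 .
    have "nn_avg Q (\<lambda>x. inverse (ennreal (v x powr \<sigma>))) \<le> nn_avg Q (\<lambda>x. ennreal (exp (- \<theta> * \<sigma> * c)) *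
       (ennpowr (inverse (ennreal ((w x powr (\<eta> * \<theta>)) powr \<sigma>))) (1/\<eta>) *
        ennpowr (ennreal (exp (X x))) (\<mu> * \<sigma>)))"
    proof (rule nn_avg_mono)
      fix x
      show "inverse (ennreal (v x powr \<sigma>)) \<le> ennreal (exp (- \<theta> * \<sigma> * c)) *
       (ennpowr (inverse (ennreal ((w x powr (\<eta> * \<theta>)) powr \<sigma>))) (1/\<eta>) *
        ennpowr (ennreal (exp (X x))) (\<mu> * \<sigma>))"
      proof (cases "w x = 0")
        \<comment> \<open>Both sides are infinite: the dual weights are formed with
          \<open>inverse\<close>, and \<open>v\<close> vanishes where \<open>w\<close> does.\<close>
        case True
        then show ?thesis by (simp add: ennreal_mult_eq_top_iff ennpowr_ennreal v_def)
      next
        case False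
        then have wx: "0 < w x" using w0[of x] by simp
        have "inverse (v x powr \<sigma>) = inverse (w x powr (\<theta> * \<sigma>)) * exp (- (\<theta> * \<sigma>) * u x)"
          using wx by (simp add: v_def powr_mult exp_powr_real powr_powr exp_minus field_simps)
        also have "\<dots> \<le> inverse (w x powr (\<theta> * \<sigma>)) * exp (- (\<theta> * \<sigma>) * c + \<mu> * \<sigma> * X x)"
        proof -
          have "\<theta> * (c - u x) \<le> \<theta> * \<bar>u x - c\<bar>"
            using \<theta> by (intro mult_left_mono) auto
          also note uc[of x]
          finally have "\<sigma> * (\<theta> * (c - u x)) \<le> \<sigma> * (\<mu> * X x)"
            using \<sigma>0 by (intro mult_left_mono) auto
          then show ?thesis by (intro mult_left_mono) (auto simp: algebra_simps)
        qed
        also have "\<dots> = exp (- \<theta> * \<sigma> * c) * (inverse (w x powr (\<theta> * \<sigma>)) * exp (\<mu> * \<sigma> * X x))"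
          unfolding exp_add by (simp add: mult_ac)
        finally have "ennreal (inverse (v x powr \<sigma>))
            \<le> ennreal (exp (- \<theta> * \<sigma> * c) * (inverse (w x powr (\<theta> * \<sigma>)) * exp (\<mu> * \<sigma> * X x)))"
          by (rule ennreal_leI)
        moreover have "ennpowr (inverse (ennreal ((w x powr (\<eta> * \<theta>)) powr \<sigma>))) (1/\<eta>)
            = ennreal (inverse (w x powr (\<theta> * \<sigma>)))"
          using wx \<eta> by (subst ennpowr_inverse) (auto simp: powr_powr inverse_ennreal)
        moreover have "ennpowr (ennreal (exp (X x))) (\<mu> * \<sigma>) = ennreal (exp (\<mu> * \<sigma> * X x))"
          by (simp add: ennpowr_ennreal exp_powr_real mult.commute)
        moreover have "0 < v x powr \<sigma>" using wx by (simp add: v_def)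
        ultimately show ?thesis
          by (simp add: inverse_ennreal flip: ennreal_mult)
      qed
    qed
    also have "\<dots> = ennreal (exp (- \<theta> * \<sigma> * c)) * nn_avg Q (\<lambda>x. 
       ennpowr (inverse (ennreal ((w x powr (\<eta> * \<theta>)) powr \<sigma>))) (1/\<eta>) *
        ennpowr (ennreal (exp (X x))) (\<mu> * \<sigma>))"
      by (rule nn_avg_cmult[OF Q]) measurable
    also have "\<dots> \<le> ennreal (exp (- \<theta> * \<sigma> * c)) * (ennpowr (B Q) (1/\<eta>) *
        ennpowr (nn_avg Q (\<lambda>x. ennreal (exp (X x)))) (\<mu> * \<sigma>))"
      unfolding B_def by (intro mult_left_mono nn_avg_Holder[OF Q]) (use \<mu>\<sigma> \<mu>0 \<sigma>0 \<eta> in auto)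
    also have "\<dots> \<le> ennreal (exp (- \<theta> * \<sigma> * c)) * (ennpowr (B Q) (1/\<eta>) * ennpowr 2 (\<mu> * \<sigma>))"
      using \<mu>0 \<sigma>0 X2 by (intro mult_left_mono ennpowr_mono) auto
    finally show ?P2 .
  qed
  have two: "ennpowr 2 a = ennreal (2 powr a)" for a
    using ennpowr_ennreal[of 2 a] by simp
  have Aeq: "Ap_const s (\<lambda>x. w x powr (\<eta> * \<theta>)) = (SUP Q \<in> cubes. A Q * ennpowr (B Q) (s - 1))"
    unfolding Ap_const_def A_def B_def \<sigma>_def conj_exp_minus_1[OF s] ..
  show le: "Ap_const s v \<le> ennreal (4 powr (\<theta> * \<delta>)) * ennpowr (Ap_const s (\<lambda>x. w x powr (\<eta> * \<theta>))) (1 / \<eta>)"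
    unfolding Ap_const_def[of s v] conj_exp_minus_1[OF s] \<sigma>_def[symmetric]
  proof (rule SUP_least)
    fix Q :: "(real^'n) set" assume Q: "Q \<in> cubes"
    obtain c where c: "\<And>x. \<bar>u x - c\<bar> \<le> \<rho> * norm (b x - avg Q b)" using u[OF Q] by blast
    have "nn_avg Q (\<lambda>x. ennreal (v x)) * ennpowr (nn_avg Q (\<lambda>x. inverse (ennreal (v x powr \<sigma>)))) (s - 1)
      \<le> (ennreal (exp (\<theta> * c)) * (ennpowr (A Q) (1/\<eta>) * ennpowr 2 \<mu>)) *
        ennpowr (ennreal (exp (- \<theta> * \<sigma> * c)) * (ennpowr (B Q) (1/\<eta>) * ennpowr 2 (\<mu> * \<sigma>))) (s - 1)"
      using s by (intro mult_mono ennpowr_mono main[OF Q c]) auto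
    also have "ennpowr (ennreal (exp (- \<theta> * \<sigma> * c)) * (ennpowr (B Q) (1/\<eta>) * ennpowr 2 (\<mu> * \<sigma>))) (s - 1)
       = ennreal (exp (- \<theta> * c)) * (ennpowr (ennpowr (B Q) (s - 1)) (1/\<eta>) * ennpowr 2 \<mu>)"
    proof -
      \<comment> \<open>The outer power \<open>s - 1\<close> cancels \<sigma>. Hence the constant
        becomes exp (- \<theta> c), the reciprocal of the one from the first average, and both
        averages carry the same power of 2.\<close>
      have e: "- \<theta> * \<sigma> * c * (s - 1) = - \<theta> * c" "\<mu> * \<sigma> * (s - 1) = \<mu>"
        using \<sigma>s by algebra+
      show ?thesis
        unfolding ennpowr_mult ennpowr_ennpowr ennpowr_ennreal[OF exp_ge_zero] exp_powr_real e
        by (simp add: mult.commute)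
    qed
    also have "(ennreal (exp (\<theta> * c)) * (ennpowr (A Q) (1/\<eta>) * ennpowr 2 \<mu>)) *
        (ennreal (exp (- \<theta> * c)) * (ennpowr (ennpowr (B Q) (s - 1)) (1/\<eta>) * ennpowr 2 \<mu>))
      = (ennreal (exp (\<theta> * c)) * ennreal (exp (- \<theta> * c))) * (ennpowr 2 \<mu> * ennpowr 2 \<mu>) *
         (ennpowr (A Q) (1/\<eta>) * ennpowr (ennpowr (B Q) (s - 1)) (1/\<eta>))"
      by (simp only: mult_ac)
    also have "ennreal (exp (\<theta> * c)) * ennreal (exp (- \<theta> * c)) = 1"
      by (simp flip: ennreal_mult exp_add)
    also have "ennpowr 2 \<mu> * ennpowr 2 \<mu> = ennreal (4 powr (\<theta> * \<delta>))"
      unfolding two \<mu>_def by (simp flip: ennreal_mult powr_mult)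
    also have "1 * ennreal (4 powr (\<theta> * \<delta>)) * (ennpowr (A Q) (1/\<eta>) * ennpowr (ennpowr (B Q) (s - 1)) (1/\<eta>))
       = ennreal (4 powr (\<theta> * \<delta>)) * ennpowr (A Q * ennpowr (B Q) (s - 1)) (1/\<eta>)"
      by (simp add: ennpowr_mult)
    also have "\<dots> \<le> ennreal (4 powr (\<theta> * \<delta>)) * ennpowr (Ap_const s (\<lambda>x. w x powr (\<eta> * \<theta>))) (1 / \<eta>)"
      unfolding Aeq using \<eta> by (intro mult_left_mono ennpowr_mono SUP_upper Q) auto
    finally show "nn_avg Q (\<lambda>x. ennreal (v x)) * ennpowr (nn_avg Q (\<lambda>x. inverse (ennreal (v x powr \<sigma>)))) (s - 1)
      \<le> ennreal (4 powr (\<theta> * \<delta>)) * ennpowr (Ap_const s (\<lambda>x. w x powr (\<eta> * \<theta>))) (1 / \<eta>)" .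
  qed
  show "Ap_weight s v"
    unfolding Ap_weight_def weight_def
  proof (intro conjI allI)
    show "0 \<le> v x" for x by (rule v0)
    show "locally_integrable v"
    proof (rule locally_integrableI_nn_avg[OF vm v0])
      fix Q :: "(real^'n) set" assume Q: "Q \<in> cubes"
      obtain c where c: "\<And>x. \<bar>u x - c\<bar> \<le> \<rho> * norm (b x - avg Q b)" using u[OF Q] by blast
      have "set_integrable lebesgue Q (\<lambda>x. w x powr (\<eta> * \<theta>))"
        using Ap cubes_emeasure(4)[OF Q] by (simp add: Ap_weight_def weight_def locally_integrable_def)
      then have "integrable lebesgue (\<lambda>x. indicator Q x * w x powr (\<eta> * \<theta>))"
        by (simp add: set_integrable_def)
      then have "(\<integral>\<^sup>+ x. ennreal (norm (indicator Q x * w x powr (\<eta> * \<theta>))) \<partial>lebesgue) < \<infinity>"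
        by (simp add: integrable_iff_bounded)
      also have "(\<integral>\<^sup>+ x. ennreal (norm (indicator Q x * w x powr (\<eta> * \<theta>))) \<partial>lebesgue)
          = (\<integral>\<^sup>+ x \<in> Q. ennreal (w x powr (\<eta> * \<theta>)) \<partial>lebesgue)"
        by (intro nn_integral_cong) (auto split: split_indicator)
      finally have "A Q < top"
        using cubes_emeasure(1)[OF Q]
        by (auto simp: A_def nn_avg_def less_top[symmetric] ennreal_divide_eq_top_iff)
      then have "ennreal (exp (\<theta> * c)) * (ennpowr (A Q) (1/\<eta>) * ennpowr 2 \<mu>) < top"
        by (simp add: ennreal_mult_less_top two)
      with main(1)[OF Q c] show "nn_avg Q (\<lambda>x. ennreal (v x)) < top"
        by (rule le_less_trans)
    qed
    show "\<not> (AE x in lebesgue. v x = 0)"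
      using Ap by (simp add: Ap_weight_def v_def)
    have "Ap_const s (\<lambda>x. w x powr (\<eta> * \<theta>)) < top" using Ap by (simp add: Ap_weight_def)
    then have "ennreal (4 powr (\<theta> * \<delta>)) * ennpowr (Ap_const s (\<lambda>x. w x powr (\<eta> * \<theta>))) (1 / \<eta>) < top"
      by (simp add: ennreal_mult_less_top)
    with le show "Ap_const s v < top" by (rule le_less_trans)
  qed
qed

section \<open>Iterated commutators and discrete Cauchy means\<close>

text \<open>The one-slot counterpart of \<open>commutator\<close>, for the operator obtained by
  freezing all other entries; \<open>commutator_iterate_slot\<close> links the two.\<close>

definition lin_commutator ::
    "('a \<Rightarrow> complex) \<Rightarrow> (('a \<Rightarrow> complex) \<Rightarrow> 'a \<Rightarrow> complex) \<Rightarrow> ('a \<Rightarrow> complex) \<Rightarrow> 'a \<Rightarrow> complex" where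
  "lin_commutator b S = (\<lambda>g x. b x * S g x - S (\<lambda>y. b y * g y) x)"

text \<open>Pascal's rule. The induction keeps \<open>g\<close> arbitrary because one more
  commutator also evaluates the previous iterate at \<open>b * g\<close>, which shifts the index
  \<open>l\<close> by one.\<close>

lemma lin_commutator_iterate:
  "(lin_commutator b ^^ k) S g x =
     (\<Sum>l\<le>k. of_nat (k choose l) * (-1) ^ l * b x ^ (k - l) * S (\<lambda>y. b y ^ l * g y) x)"
proof (induction k arbitrary: g)
  case (Suc k)
  define a where "a = (\<lambda>l. S (\<lambda>y. b y ^ l * g y) x)"
  define B where "B = b x"
  have sh: "(\<lambda>y. b y ^ l * (b y * g y)) = (\<lambda>y. b y ^ Suc l * g y)" for l
    by (simp add: mult_ac)
  have "(lin_commutator b ^^ Suc k) S g x =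
     B * (\<Sum>l\<le>k. of_nat (k choose l) * (-1) ^ l * B ^ (k - l) * a l)
     - (\<Sum>l\<le>k. of_nat (k choose l) * (-1) ^ l * B ^ (k - l) * a (Suc l))"
    unfolding a_def B_def funpow.simps o_apply
    by (subst lin_commutator_def) (simp only: Suc.IH sh)
  also have "B * (\<Sum>l\<le>k. of_nat (k choose l) * (-1) ^ l * B ^ (k - l) * a l)
     = (\<Sum>l\<le>Suc k. of_nat (k choose l) * (-1) ^ l * B ^ (Suc k - l) * a l)"
    by (simp add: sum_distrib_left Suc_diff_le mult_ac)
  also have "\<dots> = B ^ Suc k * a 0 + (\<Sum>l\<le>k. of_nat (k choose Suc l) * (-1) ^ Suc l * B ^ (k - l) * a (Suc l))"
    by (subst sum.atMost_Suc_shift) simp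
  also have "\<dots> - (\<Sum>l\<le>k. of_nat (k choose l) * (-1) ^ l * B ^ (k - l) * a (Suc l))
     = B ^ Suc k * a 0 + (\<Sum>l\<le>k. of_nat (Suc k choose Suc l) * (-1) ^ Suc l * B ^ (k - l) * a (Suc l))"
    by (simp add: algebra_simps sum.distrib sum_negf sum_subtractf)
  also have "\<dots> = (\<Sum>l\<le>Suc k. of_nat (Suc k choose l) * (-1) ^ l * B ^ (Suc k - l) * a l)"
    by (subst sum.atMost_Suc_shift) simp
  finally show ?case unfolding a_def B_def .
qed simp

text \<open>For distinct \<open>i\<close> and \<open>j\<close> below \<open>n\<close>, the ratio
  \<omega>^i / \<omega>^j is an n-th root of unity different from 1, so its geometric sum vanishes.
  Quotients are used in place of powers with exponent \<open>i - j\<close>, which may be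
  negative.\<close>

lemma sum_roots_of_unity_quotient:
  fixes z :: "nat \<Rightarrow> complex"
  assumes "i < n" "j < n" "r \<noteq> 0"
  defines "z \<equiv> \<lambda>k. of_real r * cis (2 * pi * real k / real n)"
  shows "(\<Sum>k<n. z k ^ i / z k ^ j) = (if i = j then of_nat n else 0)"
proof (cases "i = j")
  case True
  then show ?thesis using assms by (simp add: z_def)
next
  case False
  have n: "n > 0" using assms by simp
  define \<omega> where "\<omega> = cis (2 * pi / real n)"
  have \<omega>: "cis (2 * pi * real k / real n) = \<omega> ^ k" for k
    unfolding \<omega>_def Complex.DeMoivre by (simp add: mult_ac)
  have \<omega>0: "\<omega> \<noteq> 0" by (simp add: \<omega>_def)
  have \<omega>n: "\<omega> ^ n = 1" using n by (simp add: \<omega>_def Complex.DeMoivre)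
  have "inj_on (\<lambda>k. cis (2 * pi * real k / real n)) {..<n}"
    using Complex.bij_betw_roots_unity[OF n] by (simp add: bij_betw_def)
  then have "\<omega> ^ i \<noteq> \<omega> ^ j"
    using False assms(1,2) unfolding \<omega> by (auto dest: inj_onD)
  define \<zeta> where "\<zeta> = \<omega> ^ i / \<omega> ^ j"
  have \<zeta>1: "\<zeta> \<noteq> 1" using \<open>\<omega> ^ i \<noteq> \<omega> ^ j\<close> \<omega>0 by (simp add: \<zeta>_def)
  have \<zeta>n: "\<zeta> ^ n = 1"
    by (simp add: \<zeta>_def power_divide power_mult[symmetric] mult.commute[of _ n])
       (simp add: power_mult \<omega>n \<omega>0)
  have "(\<Sum>k<n. z k ^ i / z k ^ j) = (\<Sum>k<n. of_real r ^ i / of_real r ^ j * \<zeta> ^ k)"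
    by (simp add: z_def \<omega> \<zeta>_def power_mult_distrib power_divide power_mult[symmetric] mult.commute[of i] mult.commute[of j])
  also have "\<dots> = of_real r ^ i / of_real r ^ j * ((\<zeta> ^ n - 1) / (\<zeta> - 1))"
    unfolding sum_distrib_left[symmetric] geometric_sum[OF \<zeta>1] ..
  finally show ?thesis using False \<zeta>n by simp
qed

section \<open>Taylor polynomials of the exponential function\<close>

definition exp_poly :: "nat \<Rightarrow> complex \<Rightarrow> complex" where
  "exp_poly M z = (\<Sum>i\<le>M. z ^ i / fact i)"

lemma norm_exp_poly_le: "norm (exp_poly M z) \<le> exp (norm z)"
proof -
  have "norm (exp_poly M z) \<le> (\<Sum>i\<le>M. norm z ^ i / fact i)"
    unfolding exp_poly_def by (rule order_trans[OF norm_sum]) (simp add: norm_divide norm_power)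
  also have "\<dots> \<le> (\<Sum>i. norm z ^ i / fact i)"
    using summable_exp[of "norm z"] by (intro sum_le_suminf) (auto simp: field_simps)
  also have "\<dots> = exp (norm z)" by (simp add: exp_def field_simps)
  finally show ?thesis .
qed

text \<open>In the tail each term (r a)^i is (r / R)^i (R a)^i, and (r / R)^i is at most (r / R)^M.
  Enlarging the exponent from \<open>r\<close> to \<open>R\<close> thus buys a decay in
  \<open>M\<close> that is uniform in \<open>a\<close>; this matters because \<open>a\<close> will
  be the unbounded function |b|.\<close>

lemma exp_poly_remainder:
  assumes "norm z \<le> r * a" "0 < r" "r < R" "0 \<le> a"
  shows "norm (exp z - exp_poly M z) \<le> (r / R) ^ M * exp (R * a)"
proof -
  have sm: "summable (\<lambda>i. z ^ i / fact i)"
    using summable_exp[of z] by (simp add: field_simps)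
  have smR: "summable (\<lambda>i. (R * a) ^ i / fact i)"
    using summable_exp[of "R * a"] by (simp add: field_simps)
  have smR': "summable (\<lambda>i. (R * a) ^ (i + Suc M) / fact (i + Suc M))"
    by (rule summable_ignore_initial_segment[OF smR])
  have "exp z = (\<Sum>i. z ^ i / fact i)" by (simp add: exp_def scaleR_conv_of_real field_simps)
  also have "\<dots> = (\<Sum>i. z ^ (i + Suc M) / fact (i + Suc M)) + (\<Sum>i<Suc M. z ^ i / fact i)"
    by (rule suminf_split_initial_segment[OF sm])
  finally have "norm (exp z - exp_poly M z) = norm (\<Sum>i. z ^ (i + Suc M) / fact (i + Suc M))"
    by (simp add: exp_poly_def lessThan_Suc_atMost)
  also have "\<dots> \<le> (\<Sum>i. (r / R) ^ M * ((R * a) ^ (i + Suc M) / fact (i + Suc M)))"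
  proof (rule norm_suminf_le)
    fix i
    have "norm z ^ (i + Suc M) \<le> (r * a) ^ (i + Suc M)"
      using assms by (intro power_mono) auto
    also have "\<dots> = (r / R) ^ (i + Suc M) * (R * a) ^ (i + Suc M)"
      using assms by (simp add: power_mult_distrib[symmetric] del: power_Suc)
    also have "\<dots> \<le> (r / R) ^ M * (R * a) ^ (i + Suc M)"
      using assms by (intro mult_right_mono power_decreasing) auto
    finally show "norm (z ^ (i + Suc M) / fact (i + Suc M))
        \<le> (r / R) ^ M * ((R * a) ^ (i + Suc M) / fact (i + Suc M))"
      by (simp add: norm_divide norm_power divide_right_mono del: power_Suc fact_Suc)
  qed (rule summable_mult[OF smR'])
  also have "\<dots> = (r / R) ^ M * (\<Sum>i. (R * a) ^ (i + Suc M) / fact (i + Suc M))"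
    by (rule suminf_mult[OF smR'])
  also have "(\<Sum>i. (R * a) ^ (i + Suc M) / fact (i + Suc M)) \<le> exp (R * a)"
  proof -
    have "exp (R * a) = (\<Sum>i. (R * a) ^ i / fact i)" by (simp add: exp_def field_simps)
    also have "\<dots> = (\<Sum>i. (R * a) ^ (i + Suc M) / fact (i + Suc M)) + (\<Sum>i<Suc M. (R * a) ^ i / fact i)"
      by (rule suminf_split_initial_segment[OF smR])
    finally show ?thesis using assms by (simp add: sum_nonneg del: power_Suc fact_Suc sum.lessThan_Suc)
  qed
  finally show ?thesis using assms by (simp add: mult_left_mono)
qed

text \<open>The number \<^term>\<open>n\<close> of roots of unity exceeds \<^term>\<open>\<alpha>\<close> and every exponent
  \<^term>\<open>i + l\<close> that occurs in the product, so there is no aliasing.\<close>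

lemma discrete_Cauchy:
  fixes B :: complex and a :: "nat \<Rightarrow> complex"
  assumes M: "\<alpha> \<le> M" and n: "n = 2 * M + \<alpha> + 1" and r: "r \<noteq> 0"
  defines "z \<equiv> \<lambda>k. of_real r * cis (2 * pi * real k / real n)"
  shows "(\<Sum>k<n. exp_poly M (z k * B) * (\<Sum>l\<le>M. (- z k) ^ l / fact l * a l) / z k ^ \<alpha>) / of_nat n
    = (\<Sum>l\<le>\<alpha>. of_nat (\<alpha> choose l) * (-1) ^ l * B ^ (\<alpha> - l) * a l) / fact \<alpha>"
proof -
  define c where "c = (\<lambda>i l. B ^ i / fact i * ((-1) ^ l / fact l * a l))"
  have t: "exp_poly M (z k * B) * (\<Sum>l\<le>M. (- z k) ^ l / fact l * a l) / z k ^ \<alpha>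
     = (\<Sum>i\<le>M. \<Sum>l\<le>M. c i l * (z k ^ (i + l) / z k ^ \<alpha>))" for k
  proof -
    have "exp_poly M (z k * B) * (\<Sum>l\<le>M. (- z k) ^ l / fact l * a l) / z k ^ \<alpha>
      = (\<Sum>i\<le>M. \<Sum>l\<le>M. ((z k * B) ^ i / fact i) * ((- z k) ^ l / fact l * a l) / z k ^ \<alpha>)"
      by (simp only: exp_poly_def sum_product sum_divide_distrib)
    also have "\<dots> = (\<Sum>i\<le>M. \<Sum>l\<le>M. c i l * (z k ^ (i + l) / z k ^ \<alpha>))"
      by (intro sum.cong refl) (simp add: c_def power_mult_distrib power_add power_minus[of "z k"] mult_ac)
    finally show ?thesis .
  qed
  have "(\<Sum>k<n. exp_poly M (z k * B) * (\<Sum>l\<le>M. (- z k) ^ l / fact l * a l) / z k ^ \<alpha>)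
     = (\<Sum>k<n. \<Sum>i\<le>M. \<Sum>l\<le>M. c i l * (z k ^ (i + l) / z k ^ \<alpha>))"
    by (simp only: t)
  also have "\<dots> = (\<Sum>i\<le>M. \<Sum>l\<le>M. \<Sum>k<n. c i l * (z k ^ (i + l) / z k ^ \<alpha>))"
    by (subst sum.swap, rule sum.cong[OF refl], rule sum.swap)
  also have "\<dots> = (\<Sum>i\<le>M. \<Sum>l\<le>M. c i l * (\<Sum>k<n. z k ^ (i + l) / z k ^ \<alpha>))"
    by (simp only: sum_distrib_left)
  also have "\<dots> = (\<Sum>i\<le>M. \<Sum>l\<le>M. c i l * (if i + l = \<alpha> then of_nat n else 0))"
    unfolding z_def by (intro sum.cong refl arg_cong2[where f = "(*)"] sum_roots_of_unity_quotient)
      (use n r in auto)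
  also have "\<dots> = (\<Sum>l\<le>M. \<Sum>i\<le>M. c i l * (if i + l = \<alpha> then of_nat n else 0))"
    by (rule sum.swap)
  \<comment> \<open>For fixed \<open>l\<close> only \<open>i = \<alpha> - l\<close> survives. It
    lies in the range of summation because \<alpha> \<le> M, and there is no such \<open>i\<close>
    if \<open>l\<close> exceeds \<alpha>.\<close>
  also have "\<dots> = (\<Sum>l\<le>M. if l \<le> \<alpha> then c (\<alpha> - l) l * of_nat n else 0)"
  proof (rule sum.cong[OF refl])
    fix l
    have "(\<Sum>i\<le>M. c i l * (if i + l = \<alpha> then of_nat n else 0))
        = (\<Sum>i\<le>M. if i = \<alpha> - l then (if l \<le> \<alpha> then c (\<alpha> - l) l * of_nat n else 0) else 0)"
      by (intro sum.cong) auto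
    also have "\<dots> = (if l \<le> \<alpha> then c (\<alpha> - l) l * of_nat n else 0)"
      using M by (auto simp: sum.delta)
    finally show "(\<Sum>i\<le>M. c i l * (if i + l = \<alpha> then of_nat n else 0)) = \<dots>" .
  qed
  also have "\<dots> = (\<Sum>l\<le>\<alpha>. c (\<alpha> - l) l * of_nat n)"
    using M by (intro sum.mono_neutral_cong_right) auto
  also have "\<dots> / of_nat n = (\<Sum>l\<le>\<alpha>. c (\<alpha> - l) l)"
  proof -
    have "(of_nat n :: complex) \<noteq> 0" using n unfolding of_nat_eq_0_iff by simp
    then show ?thesis by (simp flip: sum_distrib_right)
  qed
  also have "\<dots> = (\<Sum>l\<le>\<alpha>. of_nat (\<alpha> choose l) * (-1) ^ l * B ^ (\<alpha> - l) * a l / fact \<alpha>)"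
  proof (rule sum.cong[OF refl])
    fix l assume "l \<in> {..\<alpha>}"
    then have "(of_nat (\<alpha> choose l) :: complex) = fact \<alpha> / (fact l * fact (\<alpha> - l))"
      by (intro binomial_fact) auto
    then show "c (\<alpha> - l) l = of_nat (\<alpha> choose l) * (-1) ^ l * B ^ (\<alpha> - l) * a l / fact \<alpha>"
      by (simp add: c_def mult_ac)
  qed
  finally show ?thesis by (simp add: sum_divide_distrib)
qed

section \<open>Convexity of powers\<close>

lemma convex_on_powr_nonneg:
  assumes "1 \<le> p" shows "convex_on {0..} (\<lambda>x::real. x powr p)"
proof (rule convex_onI)
  fix t x y :: real assume t: "0 < t" "t < 1" and xy: "x \<in> {0..}" "y \<in> {0..}"
  \<comment> \<open>If one of the two points is 0, convexity reduces to a^p \<le> a for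
    \<open>a\<close> between 0 and 1.\<close>
  have shrink: "(a * z) powr p \<le> a * z powr p" if "0 < a" "a < 1" "0 \<le> z" for a z :: real
  proof -
    have "a powr p \<le> a powr 1" using that assms by (intro powr_mono') auto
    then show ?thesis using that by (simp add: powr_mult mult_right_mono)
  qed
  consider "x = 0" | "y = 0" | "0 < x" "0 < y" using xy by fastforce
  then show "((1 - t) *\<^sub>R x + t *\<^sub>R y) powr p \<le> (1 - t) * x powr p + t * y powr p"
  proof cases
    case 3
    then show ?thesis using powr_convex[OF assms] t by (auto simp: convex_on_def)
  qed (use shrink[of t y] shrink[of "1 - t" x] t xy in auto)
qed simp

text \<open>Convexity applied to x + y = (1 - t) (x / (1 - t)) + t (y / t). The factor on
  \<open>x\<close> tends to 1 as \<open>t\<close> tends to 0, so a main term \<open>x\<close> keeps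
  its sharp constant when the error \<open>y\<close> is negligible; \<open>powr_add_le\<close> is
  the crude version, used inside the error itself.\<close>

lemma powr_add_le_weighted:
  fixes x y :: real
  assumes "0 \<le> x" "0 \<le> y" "1 \<le> p" "0 < t" "t < 1"
  shows "(x + y) powr p \<le> (1 - t) powr (1 - p) * x powr p + t powr (1 - p) * y powr p"
proof -
  have "((1 - t) *\<^sub>R (x / (1 - t)) + t *\<^sub>R (y / t)) powr p
      \<le> (1 - t) * (x / (1 - t)) powr p + t * (y / t) powr p"
    using assms by (intro convex_onD[OF convex_on_powr_nonneg]) auto
  then show ?thesis using assms by (simp add: powr_divide powr_diff)
qed

lemma powr_add_le:
  fixes x y :: real
  assumes "0 \<le> x" "0 \<le> y" "1 \<le> p"
  shows "(x + y) powr p \<le> 2 powr p * (x powr p + y powr p)"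
proof -
  have "(x + y) powr p \<le> (2 * max x y) powr p" using assms by (intro powr_mono2) auto
  also have "\<dots> = 2 powr p * (max x y) powr p" using assms by (simp add: powr_mult)
  also have "\<dots> \<le> 2 powr p * (x powr p + y powr p)"
    by (intro mult_left_mono) (auto simp: max_def)
  finally show ?thesis .
qed

lemma powr_mean_le:
  fixes a :: "nat \<Rightarrow> real"
  assumes "0 < n" "1 \<le> p" "\<And>k. 0 \<le> a k"
  shows "((\<Sum>k<n. a k) / n) powr p \<le> (\<Sum>k<n. a k powr p) / n"
proof -
  have "(\<Sum>k<n. (1 / n) *\<^sub>R a k) powr p \<le> (\<Sum>k<n. (1 / n) * a k powr p)"
    using assms by (intro convex_on_sum[OF _ _ convex_on_powr_nonneg]) auto
  then show ?thesis by (simp add: sum_divide_distrib)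
qed

section \<open>Commutators of linear operators\<close>

text \<open>The p-th power of \<open>Lp_norm\<close>. Sums are estimated on this level, where
  pointwise convexity of the power \<open>p\<close> takes the place of Minkowski's
  inequality.\<close>

definition wint :: "real \<Rightarrow> (real^'n \<Rightarrow> real) \<Rightarrow> (real^'n \<Rightarrow> complex) \<Rightarrow> ennreal" where
  "wint p W h = (\<integral>\<^sup>+ x. ennreal (norm (h x) powr p * W x) \<partial>lebesgue)"

lemma Lp_norm_wint: "Lp_norm p W h = ennpowr (wint p W h) (1 / p)"
  by (simp add: Lp_norm_def wint_def)

lemma wint_Lp_norm: "p \<noteq> 0 \<Longrightarrow> wint p W h = ennpowr (Lp_norm p W h) p"
  by (simp add: Lp_norm_wint ennpowr_ennpowr)

lemma wint_mono:
  assumes "AE x in lebesgue. norm (g x) powr p * V x \<le> norm (h x) powr p * W x"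
  shows "wint p V g \<le> wint p W h"
  unfolding wint_def
  by (intro nn_integral_mono_AE) (use assms in \<open>auto elim!: eventually_mono intro: ennreal_leI\<close>)

lemma Lp_norm_mono:
  assumes "AE x in lebesgue. norm (g x) powr p * V x \<le> norm (h x) powr p * W x" "0 < p"
  shows "Lp_norm p V g \<le> Lp_norm p W h"
  unfolding Lp_norm_wint using wint_mono[OF assms(1)] assms(2) by (intro ennpowr_mono) auto

lemma Lp_norm_cmult:
  assumes "0 < p" and [measurable]: "h \<in> borel_measurable lebesgue" "W \<in> borel_measurable lebesgue"
    and W: "\<And>x. 0 \<le> W x"
  shows "Lp_norm p W (\<lambda>x. c * h x) = ennreal (norm c) * Lp_norm p W h"
proof -
  have "wint p W (\<lambda>x. c * h x) = (\<integral>\<^sup>+ x. ennreal (norm c powr p) * ennreal (norm (h x) powr p * W x) \<partial>lebesgue)"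
    unfolding wint_def using W
    by (intro nn_integral_cong) (simp add: norm_mult powr_mult mult.assoc flip: ennreal_mult)
  also have "\<dots> = ennpowr (ennreal (norm c)) p * wint p W h"
    unfolding wint_def by (subst nn_integral_cmult) (auto simp: ennpowr_ennreal)
  finally show ?thesis
    unfolding Lp_norm_wint using assms(1) by (simp add: ennpowr_mult ennpowr_ennpowr)
qed

text \<open>Fatou's lemma, as the sets where |b| is at most \<open>N\<close> exhaust the space. The
  point is that \<open>C\<close> is independent of \<open>N\<close>.\<close>

lemma wint_le_of_cutoffs:
  fixes b h :: "real^'n \<Rightarrow> complex"
  assumes [measurable]: "b \<in> borel_measurable lebesgue" "h \<in> borel_measurable lebesgue" "W \<in> borel_measurable lebesgue"
    and cut: "\<And>N. wint p (\<lambda>x. indicator {x. norm (b x) \<le> real N} x * W x) h \<le> C"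
  shows "wint p W h \<le> C"
proof -
  let ?f = "\<lambda>N x. ennreal (norm (h x) powr p * (indicator {x. norm (b x) \<le> real N} x * W x))"
  have lim: "(\<lambda>N. ?f N x) \<longlonglongrightarrow> ennreal (norm (h x) powr p * W x)" for x
  proof (rule tendsto_eventually)
    obtain n0 where "norm (b x) \<le> real n0" using real_arch_simple by blast
    then show "\<forall>\<^sub>F N in sequentially. ?f N x = ennreal (norm (h x) powr p * W x)"
      by (intro eventually_sequentiallyI[of n0]) (auto simp: indicator_def)
  qed
  have "wint p W h = (\<integral>\<^sup>+ x. liminf (\<lambda>N. ?f N x) \<partial>lebesgue)"
    unfolding wint_def
    by (intro nn_integral_cong) (rule lim_imp_Liminf[OF _ lim, symmetric], simp)
  also have "\<dots> \<le> liminf (\<lambda>N. \<integral>\<^sup>+ x. ?f N x \<partial>lebesgue)"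
    by (rule nn_integral_liminf) measurable
  also have "\<dots> \<le> C"
    using cut unfolding wint_def by (intro Liminf_le) auto
  finally show ?thesis .
qed

text \<open>The bound for \<^term>\<open>u = (\<lambda>x. - R * norm (b x))\<close> only serves to make the Taylor remainders
  negligible.\<close>

lemma commutator_bound:
  fixes S :: "(real^'n \<Rightarrow> complex) \<Rightarrow> real^'n \<Rightarrow> complex" and b f :: "real^'n \<Rightarrow> complex"
    and w W :: "real^'n \<Rightarrow> real" and p q r R :: real and K :: ennreal
  assumes p: "1 \<le> p" and q: "0 < q" and rR: "0 < r" "r < R"
    and bm[measurable]: "b \<in> borel_measurable lebesgue"
    and wm[measurable]: "w \<in> borel_measurable lebesgue" and w0: "\<And>x. 0 \<le> w x"
    and Wm[measurable]: "W \<in> borel_measurable lebesgue" and W0: "\<And>x. 0 \<le> W x"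
    and Em: "E \<subseteq> borel_measurable lebesgue"
    and E0: "(\<lambda>_. 0) \<in> E"
    and Elin: "\<And>c g h. g \<in> E \<Longrightarrow> h \<in> E \<Longrightarrow> (\<lambda>x. c * g x + h x) \<in> E"
    and Eb: "\<And>g. g \<in> E \<Longrightarrow> (\<lambda>x. b x * g x) \<in> E"
    and Sm: "\<And>g. g \<in> E \<Longrightarrow> S g \<in> borel_measurable lebesgue"
    and Slin: "\<And>c g h. g \<in> E \<Longrightarrow> h \<in> E \<Longrightarrow>
        AE x in lebesgue. S (\<lambda>y. c * g y + h y) x = c * S g x + S h x"
    and fE: "f \<in> E" and fL: "Lp_norm q (\<lambda>x. w x powr q) f < top"
    and Eexp: "\<And>z. norm z = r \<Longrightarrow> (\<lambda>x. exp (z * b x) * f x) \<in> E"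
    and K: "K < top"
    and bound: "\<And>u g. u = (\<lambda>x. - R * norm (b x)) \<or> (\<exists>z. norm z = r \<and> u = (\<lambda>x. Re (z * b x))) \<Longrightarrow>
        g \<in> E \<Longrightarrow> Lp_norm q (\<lambda>x. (w x * exp (u x)) powr q) g < top \<Longrightarrow>
        Lp_norm p (\<lambda>x. W x * (w x * exp (u x)) powr p) (S g)
          \<le> K * Lp_norm q (\<lambda>x. (w x * exp (u x)) powr q) g"
  shows "Lp_norm p (\<lambda>x. W x * w x powr p) ((lin_commutator b ^^ \<alpha>) S f)
    \<le> ennreal (fact \<alpha> / r ^ \<alpha>) * (K * Lp_norm q (\<lambda>x. w x powr q) f)"
proof -
  define L where "L = Lp_norm q (\<lambda>x. w x powr q) f"
  define C where "C = ennpowr (K * L) p"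
  have "K * L < top" using K fL by (simp add: L_def ennreal_mult_less_top)
  then have "C < top" by (simp add: C_def)
  then obtain C' where C': "0 \<le> C'" "C = ennreal C'" by (cases C) auto
  define U where "U = {u. u = (\<lambda>x. - R * norm (b x)) \<or> (\<exists>z. norm z = r \<and> u = (\<lambda>x. Re (z * b x)))}"
  define V where "V = (\<lambda>u x. W x * (w x * exp (u x)) powr p)"
  \<comment> \<open>\<open>X z\<close> is the conjugated operator applied to \<open>f\<close>, and
    \<open>P M z\<close> is the Taylor polynomial of \<open>g z\<close>. \<open>SP\<close> is
    written as an explicit sum instead of \<open>S (P M z)\<close>, with which it agrees only almost
    everywhere, so that \<open>discrete_Cauchy\<close> holds at every point. \<open>D\<close> is the
    error to be made small.\<close>
  define g where "g = (\<lambda>z x. exp (- z * b x) * f x)"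
  define P where "P = (\<lambda>M z x. \<Sum>l<Suc M. (- z) ^ l / fact l * (b x ^ l * f x))"
  define SP where "SP = (\<lambda>M z x. \<Sum>l\<le>M. (- z) ^ l / fact l * S (\<lambda>y. b y ^ l * f y) x)"
  define X where "X = (\<lambda>z x. exp (z * b x) * S (g z) x)"
  define D where "D = (\<lambda>M z x. X z x - exp_poly M (z * b x) * SP M z x)"
  have gE: "g z \<in> E" if "norm z = r" for z
    using Eexp[of "- z"] that by (simp add: g_def)
  have bl: "(\<lambda>x. b x ^ l * f x) \<in> E" for l
  proof (induction l)
    case (Suc l)
    then show ?case using Eb[OF Suc.IH] by (simp add: mult.assoc)
  qed (use fE in simp)
  \<comment> \<open>The choice c = 1 gives S 0 = S 0 + S 0 almost everywhere.\<close>
  have S0: "AE x in lebesgue. S (\<lambda>_. 0) x = 0"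
    using Slin[OF E0 E0, of 1] by simp
  have sums: "(\<lambda>x. \<Sum>l<M. c l * (b x ^ l * f x)) \<in> E \<and>
     (AE x in lebesgue. S (\<lambda>x. \<Sum>l<M. c l * (b x ^ l * f x)) x
        = (\<Sum>l<M. c l * S (\<lambda>y. b y ^ l * f y) x))" for M c
  proof (induction M)
    case 0
    then show ?case using E0 S0 by simp
  next
    case (Suc M)
    have eq: "(\<lambda>x. \<Sum>l<Suc M. c l * (b x ^ l * f x))
        = (\<lambda>x. c M * (b x ^ M * f x) + (\<Sum>l<M. c l * (b x ^ l * f x)))"
      by (simp add: add.commute)
    show ?case unfolding eq
      using Elin[OF bl conjunct1[OF Suc.IH]] Slin[OF bl conjunct1[OF Suc.IH], of "c M" M] conjunct2[OF Suc.IH]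
      by (auto elim!: eventually_elim2 simp: add.commute)
  qed
  have PE: "P M z \<in> E" for M z unfolding P_def by (rule conjunct1[OF sums])
  have SPae: "AE x in lebesgue. S (P M z) x = SP M z x" for M z
    using conjunct2[OF sums[where M = "Suc M" and c = "\<lambda>l. (- z) ^ l / fact l"]]
    unfolding P_def SP_def lessThan_Suc_atMost .
  have SPm[measurable]: "SP M z \<in> borel_measurable lebesgue" for M z
    unfolding SP_def by (intro borel_measurable_sum borel_measurable_times borel_measurable_const Sm bl)
  have Sgm[measurable]: "S (g z) \<in> borel_measurable lebesgue" if "norm z = r" for z
    using Sm gE that by blast
  have Xm: "X z \<in> borel_measurable lebesgue" if "norm z = r" for z
    using Sgm[OF that] unfolding X_def by measurable
  have epm[measurable]: "(\<lambda>x. exp_poly M (z * b x)) \<in> borel_measurable lebesgue" for M z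
    unfolding exp_poly_def by measurable
  have Dm: "D M z \<in> borel_measurable lebesgue" if "norm z = r" for M z
    using Xm[OF that] unfolding D_def by measurable
  \<comment> \<open>Used with c = 1 for the functions \<open>g z\<close>, and with c = (r / R)^M for
    the Taylor errors.\<close>
  have bound': "wint p (V u) (S h) \<le> ennreal (c powr p) * C"
    if "u \<in> U" "h \<in> E" "0 \<le> c" "Lp_norm q (\<lambda>x. (w x * exp (u x)) powr q) h \<le> ennreal c * L" for u h c
  proof -
    have fin: "Lp_norm q (\<lambda>x. (w x * exp (u x)) powr q) h < top"
      using that(4) fL by (auto simp: L_def ennreal_mult_less_top intro: le_less_trans)
    have "Lp_norm p (V u) (S h) \<le> K * Lp_norm q (\<lambda>x. (w x * exp (u x)) powr q) h"
      unfolding V_def using that(1) by (intro bound that(2) fin) (simp add: U_def)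
    also have "\<dots> \<le> K * (ennreal c * L)" by (intro mult_left_mono that(4)) auto
    also have "\<dots> = ennreal c * (K * L)" by (simp only: mult_ac)
    finally have "ennpowr (Lp_norm p (V u) (S h)) p \<le> ennpowr (ennreal c * (K * L)) p"
      using p by (intro ennpowr_mono) auto
    then show ?thesis
      using p that(3) by (simp add: wint_Lp_norm C_def ennpowr_mult ennpowr_ennreal)
  qed
  \<comment> \<open>The modulus of exp (z b) is exp (Re (z b)). Outside \<open>S\<close> this factor
    becomes part of the weight; inside, exp (- z b) cancels it, so \<open>g z\<close> has the same
    norm in the perturbed space as \<open>f\<close> has in the original one.\<close>
  have Xbound: "wint p (\<lambda>x. W x * w x powr p) (X z) \<le> C" if z: "norm z = r" for z
  proof -
    let ?u = "\<lambda>x. Re (z * b x)"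
    have "wint p (V ?u) (S (g z)) \<le> ennreal (1 powr p) * C"
    proof (rule bound')
      show "Lp_norm q (\<lambda>x. (w x * exp (?u x)) powr q) (g z) \<le> ennreal 1 * L"
        unfolding L_def ennreal_1 mult_1
        using w0 q by (intro Lp_norm_mono AE_I2)
          (auto simp: g_def norm_mult powr_mult exp_powr_real exp_minus_inverse field_simps simp flip: exp_add)
    qed (use z gE in \<open>auto simp: U_def\<close>)
    moreover have "wint p (\<lambda>x. W x * w x powr p) (X z) = wint p (V ?u) (S (g z))"
      unfolding wint_def V_def X_def using w0
      by (intro nn_integral_cong) (simp add: norm_mult powr_mult mult_ac)
    ultimately show ?thesis by simp
  qed
  define e where "e = (\<lambda>M. ((r / R) ^ M) powr p)"
  define k where "k = (\<lambda>N::nat. 2 powr p * exp (2 * R * real N * p))"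
  \<comment> \<open>With \<open>h = g z - P M z\<close>, the error is (exp - exp_poly) S (g z) +
    exp_poly S h, the exponentials being taken at z b. In the first term the outer factor is small,
    in the second the norm of \<open>h\<close>. In \<open>k N\<close>, one factor exp (R |b|) comes
    from the outer factors and the other from passing between the weights \<open>V\<close> and W
    w^p.\<close>
  have Dbound: "wint p (\<lambda>x. indicator {x. norm (b x) \<le> real N} x * (W x * w x powr p)) (D M z)
      \<le> ennreal (2 * k N * e M * C')" if z: "norm z = r" for N M z
  proof -
    let ?u = "\<lambda>x. - R * norm (b x)"
    define h where "h = (\<lambda>x. - 1 * P M z x + g z x)"
    have hE: "h \<in> E" unfolding h_def by (intro Elin PE gE z)
    have hae: "AE x in lebesgue. S h x = S (g z) x - SP M z x"
      using Slin[OF PE gE[OF z], of "- 1" M z, folded h_def] SPae[of M z] by eventually_elim simp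
    have ez: "norm (z * b x) \<le> r * norm (b x)" for x using z by (simp add: norm_mult)
    have h_eq: "h x = (exp (- z * b x) - exp_poly M (- z * b x)) * f x" for x
    proof -
      have "P M z x = exp_poly M (- z * b x) * f x"
        unfolding P_def exp_poly_def lessThan_Suc_atMost sum_distrib_right
        by (intro sum.cong refl) (simp flip: power_mult_distrib)
      then show ?thesis by (simp add: h_def g_def algebra_simps)
    qed
    have rR0: "0 \<le> (r / R) ^ M" using rR by simp
    have 1: "wint p (V ?u) (S (g z)) \<le> ennreal (1 powr p) * C"
    proof (rule bound')
      show "Lp_norm q (\<lambda>x. (w x * exp (?u x)) powr q) (g z) \<le> ennreal 1 * L"
        unfolding L_def ennreal_1 mult_1
      proof (intro Lp_norm_mono AE_I2 q)
        fix x
        have "norm (g z x) \<le> exp (R * norm (b x)) * norm (f x)"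
        proof -
          have "Re (- z * b x) \<le> norm (z * b x)" using complex_Re_le_cmod[of "- z * b x"] by simp
          also have "\<dots> \<le> R * norm (b x)" using ez[of x] rR by (smt (verit) mult_right_mono norm_ge_zero)
          finally show ?thesis by (simp add: g_def norm_mult mult_right_mono)
        qed
        then have "norm (g z x) * (w x * exp (?u x)) \<le> exp (R * norm (b x)) * norm (f x) * (w x * exp (?u x))"
          using w0 by (intro mult_right_mono) auto
        also have "\<dots> = norm (f x) * w x" by (simp add: exp_minus)
        finally have "(norm (g z x) * (w x * exp (?u x))) powr q \<le> (norm (f x) * w x) powr q"
          using q w0[of x] by (intro powr_mono2) auto
        then show "norm (g z x) powr q * (w x * exp (?u x)) powr q \<le> norm (f x) powr q * w x powr q"
          using w0[of x] by (simp add: powr_mult)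
      qed
    qed (use z gE in \<open>auto simp: U_def\<close>)
    have 2: "wint p (V ?u) (S h) \<le> ennreal (((r / R) ^ M) powr p) * C"
    proof (rule bound')
      have "Lp_norm q (\<lambda>x. (w x * exp (?u x)) powr q) h
          \<le> Lp_norm q (\<lambda>x. w x powr q) (\<lambda>x. of_real ((r / R) ^ M) * f x)"
      proof (intro Lp_norm_mono AE_I2 q)
        fix x
        have "norm (h x) \<le> ((r / R) ^ M * exp (R * norm (b x))) * norm (f x)"
          unfolding h_eq norm_mult using rR z
          by (intro mult_right_mono exp_poly_remainder) (auto simp: norm_mult)
        then have "norm (h x) * (w x * exp (?u x))
            \<le> ((r / R) ^ M * exp (R * norm (b x))) * norm (f x) * (w x * exp (?u x))"
          using w0 by (intro mult_right_mono) auto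
        also have "\<dots> = norm (of_real ((r / R) ^ M) * f x) * w x"
          using rR0 unfolding norm_mult norm_of_real by (simp add: exp_minus)
        finally have "(norm (h x) * (w x * exp (?u x))) powr q \<le> (norm (of_real ((r / R) ^ M) * f x) * w x) powr q"
          using q w0[of x] by (intro powr_mono2) auto
        then show "norm (h x) powr q * (w x * exp (?u x)) powr q
            \<le> norm (of_real ((r / R) ^ M) * f x) powr q * w x powr q"
          using w0[of x] by (simp only: powr_mult)
      qed
      also have "\<dots> = ennreal ((r / R) ^ M) * L"
      proof -
        have n: "norm (of_real ((r / R) ^ M) :: complex) = (r / R) ^ M"
          using rR0 by (simp only: norm_of_real abs_of_nonneg)
        have [measurable]: "f \<in> borel_measurable lebesgue" using fE Em by blast
        show ?thesis unfolding L_def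
          by (subst Lp_norm_cmult[OF q]) (simp_all only: n powr_ge_zero, measurable)
      qed
      finally show "Lp_norm q (\<lambda>x. (w x * exp (?u x)) powr q) h \<le> ennreal ((r / R) ^ M) * L" .
    qed (use hE rR0 in \<open>auto simp: U_def\<close>)
    have Shm[measurable]: "S h \<in> borel_measurable lebesgue" by (rule Sm[OF hE])
    have Sgz[measurable]: "S (g z) \<in> borel_measurable lebesgue" by (rule Sgm[OF z])
    have "wint p (\<lambda>x. indicator {x. norm (b x) \<le> real N} x * (W x * w x powr p)) (D M z)
      \<le> (\<integral>\<^sup>+ x. ennreal (k N * e M) * ennreal (norm (S (g z) x) powr p * V ?u x) +
               ennreal (k N) * ennreal (norm (S h x) powr p * V ?u x) \<partial>lebesgue)"
      unfolding wint_def
    proof (rule nn_integral_mono_AE, use hae in eventually_elim)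
      fix x assume hx: "S h x = S (g z) x - SP M z x"
      let ?a = "norm (b x)" and ?s = "norm (S (g z) x)" and ?t = "norm (S h x)"
      have V0: "0 \<le> V ?u x" using W0 by (simp add: V_def)
      have main: "norm (D M z x) powr p * (W x * w x powr p)
          \<le> k N * e M * (?s powr p * V ?u x) + k N * (?t powr p * V ?u x)" if aN: "?a \<le> real N"
      proof -
        have "D M z x = (exp (z * b x) - exp_poly M (z * b x)) * S (g z) x + exp_poly M (z * b x) * S h x"
          unfolding D_def X_def hx by (simp add: algebra_simps)
        then have "norm (D M z x) \<le> norm (exp (z * b x) - exp_poly M (z * b x)) * ?s + norm (exp_poly M (z * b x)) * ?t"
          by (simp only: norm_mult[symmetric] norm_triangle_ineq)
        also have "\<dots> \<le> ((r / R) ^ M * exp (R * ?a)) * ?s + exp (R * ?a) * ?t"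
        proof (intro add_mono mult_right_mono)
          show "norm (exp (z * b x) - exp_poly M (z * b x)) \<le> (r / R) ^ M * exp (R * ?a)"
            by (rule exp_poly_remainder) (use ez rR in auto)
          have "norm (z * b x) \<le> R * ?a" using ez[of x] rR by (smt (verit) mult_right_mono norm_ge_zero)
          then show "norm (exp_poly M (z * b x)) \<le> exp (R * ?a)"
            using norm_exp_poly_le[of M "z * b x"] by (smt (verit) exp_le_cancel_iff)
        qed auto
        also have "\<dots> = exp (R * ?a) * ((r / R) ^ M * ?s + ?t)" by (simp add: algebra_simps)
        finally have "norm (D M z x) powr p \<le> (exp (R * ?a) * ((r / R) ^ M * ?s + ?t)) powr p"
          using p by (intro powr_mono2) auto
        also have "\<dots> = exp (R * ?a * p) * ((r / R) ^ M * ?s + ?t) powr p"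
          using rR0 by (subst powr_mult) (auto simp: exp_powr_real)
        also have "\<dots> \<le> exp (R * ?a * p) * (2 powr p * (((r / R) ^ M * ?s) powr p + ?t powr p))"
          using rR0 p by (intro mult_left_mono powr_add_le) auto
        also have "((r / R) ^ M * ?s) powr p = e M * ?s powr p"
          unfolding e_def using rR0 by (subst powr_mult) auto
        finally have 3: "norm (D M z x) powr p * (W x * w x powr p)
           \<le> exp (R * ?a * p) * (2 powr p * (e M * ?s powr p + ?t powr p)) * (W x * w x powr p)"
          using W0 by (intro mult_right_mono) auto
        have "W x * w x powr p = exp (R * ?a * p) * V ?u x"
        proof -
          have "exp (R * ?a * p) * exp (?u x) powr p = 1"
            by (simp add: exp_powr_real flip: exp_add)
          moreover have "exp (R * ?a * p) * V ?u x = (exp (R * ?a * p) * exp (?u x) powr p) * (W x * w x powr p)"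
            unfolding V_def powr_mult by (simp only: mult_ac)
          ultimately show ?thesis by simp
        qed
        moreover have "exp (2 * (R * ?a * p)) = exp (R * ?a * p) * exp (R * ?a * p)"
          by (simp only: mult_2 exp_add)
        ultimately have "exp (R * ?a * p) * (2 powr p * (e M * ?s powr p + ?t powr p)) * (W x * w x powr p)
           = 2 powr p * exp (2 * (R * ?a * p)) * (V ?u x * (e M * ?s powr p + ?t powr p))"
          by (simp only: mult_ac)
        also have "\<dots> \<le> k N * (V ?u x * (e M * ?s powr p + ?t powr p))"
        proof (intro mult_right_mono)
          have "R * ?a * p \<le> R * real N * p" using aN rR p by (intro mult_right_mono mult_left_mono) auto
          then show "2 powr p * exp (2 * (R * ?a * p)) \<le> k N"
            unfolding k_def by (intro mult_left_mono) auto
        qed (use V0 in \<open>auto simp: e_def\<close>)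
        finally show ?thesis using 3 by (simp add: algebra_simps)
      qed
      have k0: "0 \<le> k N" "0 \<le> e M" by (auto simp: k_def e_def)
      have "norm (D M z x) powr p * (indicator {x. norm (b x) \<le> real N} x * (W x * w x powr p))
          \<le> k N * e M * (?s powr p * V ?u x) + k N * (?t powr p * V ?u x)"
        using main V0 k0 by (auto simp: indicator_def)
      then have "ennreal (norm (D M z x) powr p * (indicator {x. norm (b x) \<le> real N} x * (W x * w x powr p)))
          \<le> ennreal (k N * e M * (?s powr p * V ?u x) + k N * (?t powr p * V ?u x))"
        by (rule ennreal_leI)
      also have "\<dots> = ennreal (k N * e M) * ennreal (?s powr p * V ?u x) + ennreal (k N) * ennreal (?t powr p * V ?u x)"
        using k0 V0 by (simp flip: ennreal_mult ennreal_plus)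
      finally show "ennreal (norm (D M z x) powr p * (indicator {x. norm (b x) \<le> real N} x * (W x * w x powr p)))
          \<le> ennreal (k N * e M) * ennreal (?s powr p * V ?u x) + ennreal (k N) * ennreal (?t powr p * V ?u x)" .
    qed
    also have "\<dots> = ennreal (k N * e M) * wint p (V ?u) (S (g z)) + ennreal (k N) * wint p (V ?u) (S h)"
    proof -
      have [measurable]: "V ?u \<in> borel_measurable lebesgue" unfolding V_def by measurable
      show ?thesis unfolding wint_def
        by (subst nn_integral_add, measurable) (subst nn_integral_cmult, measurable)+
    qed
    also have "\<dots> \<le> ennreal (k N * e M) * (ennreal (1 powr p) * C) + ennreal (k N) * (ennreal (e M) * C)"
      using 1 2 unfolding e_def by (intro add_mono mult_left_mono) auto
    also have "\<dots> = ennreal (2 * k N * e M * C')"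
      using C' by (simp add: k_def e_def flip: ennreal_mult ennreal_plus)
    finally show ?thesis .
  qed
  \<comment> \<open>This normalization makes \<open>H\<close> a mean of unimodular multiples of
    \<open>X z - D M z\<close>, since |z| = r; its bound is then \<open>C\<close> with no further
    constant.\<close>
  define H where "H = (\<lambda>x. of_real (r ^ \<alpha> / fact \<alpha>) * (lin_commutator b ^^ \<alpha>) S f x)"
  have Hm[measurable]: "H \<in> borel_measurable lebesgue"
    unfolding H_def lin_commutator_iterate
    by (intro borel_measurable_times borel_measurable_const borel_measurable_sum borel_measurable_power bm Sm bl)
  have main: "wint p (\<lambda>x. indicator {x. norm (b x) \<le> real N} x * (W x * w x powr p)) H
      \<le> ennreal ((1 - t) powr (1 - p) * C' + t powr (1 - p) * (2 * k N * e M * C'))"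
    if t: "0 < t" "t < 1" and M: "\<alpha> \<le> M" for t N M
  proof -
    define n where "n = 2 * M + \<alpha> + 1"
    define z where "z = (\<lambda>k. of_real r * cis (2 * pi * real k / real n))"
    have n: "0 < n" by (simp add: n_def)
    have z: "norm (z k) = r" for k using rR by (simp add: z_def norm_mult)
    let ?I = "\<lambda>x. indicator {x. norm (b x) \<le> real N} x * (W x * w x powr p) :: real"
    have I0: "0 \<le> ?I x" for x using W0 by simp
    let ?c1 = "(1 - t) powr (1 - p)" and ?c2 = "t powr (1 - p)"
    \<comment> \<open>The triangle inequality over the roots of unity is followed by Jensen's
      inequality for the mean, and then main term and error are separated with parameter
      \<open>t\<close>.\<close>
    have pt: "norm (H x) powr p \<le> (\<Sum>k<n. 1 / n * (?c1 * norm (X (z k) x) powr p + ?c2 * norm (D M (z k) x) powr p))" for x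
    proof -
      have "(lin_commutator b ^^ \<alpha>) S f x / fact \<alpha>
          = (\<Sum>k<n. exp_poly M (z k * b x) * SP M (z k) x / z k ^ \<alpha>) / of_nat n"
        unfolding SP_def z_def lin_commutator_iterate
        using rR by (intro discrete_Cauchy[OF M n_def, symmetric]) auto
      also have "\<dots> = (\<Sum>k<n. (X (z k) x - D M (z k) x) / z k ^ \<alpha>) / of_nat n"
        by (simp add: D_def)
      finally have H: "H x = of_real (r ^ \<alpha>) * ((\<Sum>k<n. (X (z k) x - D M (z k) x) / z k ^ \<alpha>) / of_nat n)"
        by (simp add: H_def field_simps)
      have "norm (\<Sum>k<n. (X (z k) x - D M (z k) x) / z k ^ \<alpha>)
          \<le> (\<Sum>k<n. (norm (X (z k) x) + norm (D M (z k) x)) / r ^ \<alpha>)"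
        using rR by (intro order_trans[OF norm_sum] sum_mono)
          (simp add: norm_divide norm_power z divide_right_mono norm_triangle_ineq4)
      also have "\<dots> = (\<Sum>k<n. norm (X (z k) x) + norm (D M (z k) x)) / r ^ \<alpha>"
        by (simp add: sum_divide_distrib)
      finally have "norm (H x) \<le> (\<Sum>k<n. norm (X (z k) x) + norm (D M (z k) x)) / n"
        using rR n unfolding H by (simp add: norm_mult norm_divide norm_power field_simps)
      then have "norm (H x) powr p \<le> ((\<Sum>k<n. norm (X (z k) x) + norm (D M (z k) x)) / n) powr p"
        using p by (intro powr_mono2) auto
      also have "\<dots> \<le> (\<Sum>k<n. (norm (X (z k) x) + norm (D M (z k) x)) powr p) / n"
        using n p by (intro powr_mean_le) auto
      also have "\<dots> \<le> (\<Sum>k<n. ?c1 * norm (X (z k) x) powr p + ?c2 * norm (D M (z k) x) powr p) / n"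
        using p t by (intro divide_right_mono sum_mono powr_add_le_weighted) auto
      finally show ?thesis by (simp add: sum_divide_distrib)
    qed
    have Xz[measurable]: "X (z k) \<in> borel_measurable lebesgue" for k by (rule Xm[OF z])
    have Dz[measurable]: "D M (z k) \<in> borel_measurable lebesgue" for k by (rule Dm[OF z])
    have "wint p ?I H \<le> (\<integral>\<^sup>+ x. (\<Sum>k<n. ennreal (1 / n) *
        (ennreal ?c1 * ennreal (norm (X (z k) x) powr p * (W x * w x powr p))
         + ennreal ?c2 * ennreal (norm (D M (z k) x) powr p * ?I x))) \<partial>lebesgue)"
      unfolding wint_def
    proof (rule nn_integral_mono)
      fix x
      have "norm (H x) powr p * ?I x
          \<le> (\<Sum>k<n. 1 / n * (?c1 * norm (X (z k) x) powr p + ?c2 * norm (D M (z k) x) powr p)) * ?I x"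
        by (intro mult_right_mono pt I0)
      also have "\<dots> = (\<Sum>k<n. 1 / n * (?c1 * (norm (X (z k) x) powr p * ?I x) + ?c2 * (norm (D M (z k) x) powr p * ?I x)))"
        by (simp only: sum_distrib_right distrib_left distrib_right mult.assoc)
      \<comment> \<open>The cutoff is dropped on the main term, whose bound is global, and kept on
        the error.\<close>
      also have "\<dots> \<le> (\<Sum>k<n. 1 / n * (?c1 * (norm (X (z k) x) powr p * (W x * w x powr p)) + ?c2 * (norm (D M (z k) x) powr p * ?I x)))"
        using W0[of x] by (intro sum_mono mult_left_mono add_right_mono) (auto simp: indicator_def)
      finally have "ennreal (norm (H x) powr p * ?I x) \<le> ennreal \<dots>" by (rule ennreal_leI)
      also have "\<dots> = (\<Sum>k<n. ennreal (1 / n) *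
        (ennreal ?c1 * ennreal (norm (X (z k) x) powr p * (W x * w x powr p))
         + ennreal ?c2 * ennreal (norm (D M (z k) x) powr p * ?I x)))"
      proof -
        have 1: "0 \<le> norm (X (z k) x) powr p * (W x * w x powr p)" for k using W0[of x] by simp
        have 2: "0 \<le> norm (D M (z k) x) powr p * ?I x" for k
          by (rule mult_nonneg_nonneg[OF powr_ge_zero I0])
        show ?thesis
          by (subst sum_ennreal[symmetric])
             (use 1 2 in \<open>simp_all only: ennreal_mult ennreal_plus add_nonneg_nonneg mult_nonneg_nonneg powr_ge_zero of_nat_0_le_iff zero_le_divide_1_iff\<close>)
      qed
      finally show "ennreal (norm (H x) powr p * ?I x) \<le> \<dots>" .
    qed
    also have "\<dots> = (\<Sum>k<n. ennreal (1 / n) * (ennreal ?c1 * wint p (\<lambda>x. W x * w x powr p) (X (z k))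
         + ennreal ?c2 * wint p ?I (D M (z k))))"
      unfolding wint_def
      by (simp add: nn_integral_sum nn_integral_cmult nn_integral_add)
    also have "\<dots> \<le> (\<Sum>k<n. ennreal (1 / n) * (ennreal ?c1 * C + ennreal ?c2 * ennreal (2 * (2 powr p * exp (2 * R * real N * p)) * e M * C')))"
      using Dbound[OF z] unfolding k_def by (intro sum_mono mult_left_mono add_mono Xbound z) auto
    also have "\<dots> = ennreal (?c1 * C' + ?c2 * (2 * (2 powr p * exp (2 * R * real N * p)) * e M * C'))"
    proof -
      have "ennreal (real n) * ennreal (1 / real n) = 1"
        using n by (simp flip: ennreal_mult)
      then have mean: "(\<Sum>k<n. ennreal (1 / n) * x) = x" for x
        by (simp add: ennreal_of_nat_eq_real_of_nat flip: mult.assoc)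
      show ?thesis unfolding mean using C' by (simp add: e_def flip: ennreal_mult ennreal_plus)
    qed
    finally show ?thesis unfolding k_def .
  qed
  \<comment> \<open>The order of limits matters: \<open>M\<close> goes to infinity first, with
    \<open>t\<close> and \<open>N\<close> fixed, since \<open>t powr (1 - p)\<close> blows up as
    \<open>t\<close> tends to 0 and \<open>k N\<close> as \<open>N\<close> grows. Then
    \<open>t\<close> tends to 0, and \<open>N\<close> is removed last.\<close>
  have cutM: "wint p (\<lambda>x. indicator {x. norm (b x) \<le> real N} x * (W x * w x powr p)) H
      \<le> ennreal ((1 - t) powr (1 - p) * C')" if t: "0 < t" "t < 1" for t N
  proof (rule tendsto_lowerbound[of _ _ sequentially])
    have "(\<lambda>M. (r / R) ^ M) \<longlonglongrightarrow> 0" using rR by (intro LIMSEQ_realpow_zero) auto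
    then have "e \<longlonglongrightarrow> 0" unfolding e_def using p rR
      by (intro tendsto_zero_powrI[of _ _ "\<lambda>_. p" p]) auto
    then have "(\<lambda>M. (1 - t) powr (1 - p) * C' + t powr (1 - p) * (2 * k N * e M * C'))
        \<longlonglongrightarrow> (1 - t) powr (1 - p) * C' + t powr (1 - p) * (2 * k N * 0 * C')"
      by (intro tendsto_intros)
    then show "(\<lambda>M. ennreal ((1 - t) powr (1 - p) * C' + t powr (1 - p) * (2 * k N * e M * C')))
        \<longlonglongrightarrow> ennreal ((1 - t) powr (1 - p) * C')"
      by (intro tendsto_ennrealI) simp
    show "\<forall>\<^sub>F M in sequentially. wint p (\<lambda>x. indicator {x. norm (b x) \<le> real N} x * (W x * w x powr p)) H
       \<le> ennreal ((1 - t) powr (1 - p) * C' + t powr (1 - p) * (2 * k N * e M * C'))"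
      using main[OF t] by (intro eventually_sequentiallyI[of \<alpha>])
  qed simp
  have cut: "wint p (\<lambda>x. indicator {x. norm (b x) \<le> real N} x * (W x * w x powr p)) H \<le> C" for N
  proof (rule tendsto_lowerbound[of _ _ "at_right 0"])
    have "((\<lambda>t. (1 - t) powr (1 - p) * C') \<longlongrightarrow> (1 - 0) powr (1 - p) * C') (at_right 0)"
      by (intro tendsto_intros) auto
    then show "((\<lambda>t. ennreal ((1 - t) powr (1 - p) * C')) \<longlongrightarrow> C) (at_right 0)"
      unfolding C' by (intro tendsto_ennrealI) simp
    show "\<forall>\<^sub>F t in at_right 0. wint p (\<lambda>x. indicator {x. norm (b x) \<le> real N} x * (W x * w x powr p)) H
       \<le> ennreal ((1 - t) powr (1 - p) * C')"
      using cutM by (auto simp: eventually_at_right_field intro!: exI[of _ 1])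
  qed simp
  have "wint p (\<lambda>x. W x * w x powr p) H \<le> C"
    by (rule wint_le_of_cutoffs[OF bm Hm _ cut]) measurable
  then have "Lp_norm p (\<lambda>x. W x * w x powr p) H \<le> ennpowr C (1 / p)"
    unfolding Lp_norm_wint using p by (intro ennpowr_mono) auto
  also have "\<dots> = K * L" using p by (simp add: C_def ennpowr_ennpowr)
  finally have HL: "Lp_norm p (\<lambda>x. W x * w x powr p) H \<le> K * L" .
  have "(lin_commutator b ^^ \<alpha>) S f = (\<lambda>x. of_real (fact \<alpha> / r ^ \<alpha>) * H x)"
    using rR by (simp add: H_def fun_eq_iff)
  then have "Lp_norm p (\<lambda>x. W x * w x powr p) ((lin_commutator b ^^ \<alpha>) S f)
      = ennreal (norm (of_real (fact \<alpha> / r ^ \<alpha>) :: complex)) * Lp_norm p (\<lambda>x. W x * w x powr p) H"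
    using p W0 by (simp only:) (intro Lp_norm_cmult; force)
  also have "\<dots> \<le> ennreal (fact \<alpha> / r ^ \<alpha>) * (K * L)"
    using HL rR unfolding norm_of_real by (intro mult_mono) auto
  finally show ?thesis unfolding L_def .
qed

section \<open>Reduction to one slot\<close>

text \<open>The domain of a slot need not be invariant under multiplication by \<^term>\<open>b\<close>; on this part
  of it the iterated commutators are again multilinear.\<close>

definition stable_part :: "('a \<Rightarrow> complex) \<Rightarrow> ('a \<Rightarrow> complex) set \<Rightarrow> ('a \<Rightarrow> complex) set" where
  "stable_part b D = {g. \<forall>i. (\<lambda>x. b x ^ i * g x) \<in> D}"

lemma stable_part_subset: "stable_part b D \<subseteq> D"
proof
  fix g assume "g \<in> stable_part b D"
  then have "(\<lambda>x. b x ^ 0 * g x) \<in> D" unfolding stable_part_def by blast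
  then show "g \<in> D" by simp
qed

lemma stable_part_mult: "g \<in> stable_part b D \<Longrightarrow> (\<lambda>x. b x * g x) \<in> stable_part b D"
proof -
  assume g: "g \<in> stable_part b D"
  have "(\<lambda>x. b x ^ i * (b x * g x)) = (\<lambda>x. b x ^ Suc i * g x)" for i
    by (simp add: mult_ac)
  then show ?thesis using g unfolding stable_part_def by (simp del: power_Suc)
qed

lemma stable_part_lin:
  assumes lin: "\<forall>g\<in>D. \<forall>h\<in>D. \<forall>c. (\<lambda>x. c * g x + h x) \<in> D"
    and g: "g \<in> stable_part b D" and h: "h \<in> stable_part b D"
  shows "(\<lambda>x. c * g x + h x) \<in> stable_part b D"
  unfolding stable_part_def
proof (intro CollectI allI)
  fix i
  have "(\<lambda>x. c * (b x ^ i * g x) + b x ^ i * h x) \<in> D"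
    using lin g h by (simp add: stable_part_def)
  then show "(\<lambda>x. b x ^ i * (c * g x + h x)) \<in> D"
    by (simp add: distrib_left mult.left_commute)
qed

lemma stable_part_0: "(\<lambda>_. 0) \<in> D \<Longrightarrow> (\<lambda>_. 0) \<in> stable_part b D"
  by (simp add: stable_part_def)

text \<open>A single term of the exponential series; it serves to absorb powers of |b| into a
  slightly larger exponential.\<close>

lemma power_le_fact_exp:
  assumes "0 \<le> (x::real)" shows "x ^ i \<le> fact i * exp x"
proof -
  have "sum (\<lambda>j. x ^ j / fact j) {i} \<le> (\<Sum>j. x ^ j / fact j)"
    using summable_exp[of x] assms by (intro sum_le_suminf) (auto simp: field_simps)
  also have "\<dots> = exp x" by (simp add: exp_def field_simps)
  finally show ?thesis by (simp add: field_simps)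
qed

lemma BMO_measurable: "b \<in> BMO \<Longrightarrow> b \<in> borel_measurable lebesgue"
  by (simp add: BMO_def locally_integrable_measurable)

lemma Ap_weight_powr_measurable:
  assumes "Ap_weight s (\<lambda>x. v x powr a)" "a \<noteq> 0" "\<And>x. 0 \<le> v x"
  shows "v \<in> borel_measurable lebesgue"
proof -
  have "(\<lambda>x. v x powr a) \<in> borel_measurable lebesgue"
    using assms(1) by (simp add: Ap_weight_def weight_def locally_integrable_measurable)
  then have "(\<lambda>x. (v x powr a) powr (1 / a)) \<in> borel_measurable lebesgue"
    by measurable
  then show ?thesis using assms(2,3) by (simp add: powr_powr)
qed

text \<open>The data of a single slot. \<open>nb\<close> is the BMO norm as a real number; a radius
  \<rho> is admissible if \<rho> * nb < \<delta>, a condition that avoids dividing by a norm that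
  may be 0.\<close>

locale Ap_bump =
  fixes s \<theta> \<eta> \<delta> nb :: real and w :: "real^'n \<Rightarrow> real" and b :: "real^'n \<Rightarrow> complex"
  assumes s: "1 < s" and \<theta>: "0 < \<theta>" and \<eta>: "1 < \<eta>" and w0: "\<And>x. 0 \<le> w x"
    and Ap: "Ap_weight s (\<lambda>x. w x powr (\<eta> * \<theta>))"
    and b: "b \<in> BMO" and nb: "0 \<le> nb" "BMO_norm b = ennreal nb"
    and \<delta>: "\<delta> = min 1 (s - 1) / (conj_exp \<eta> * \<theta>)"
begin

lemma \<delta>0: "0 < \<delta>"
  unfolding \<delta> conj_exp_def using s \<theta> \<eta> by (intro divide_pos_pos mult_pos_pos) auto

lemma bm [measurable]: "b \<in> borel_measurable lebesgue"
  by (rule BMO_measurable[OF b])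

lemma wm [measurable]: "w \<in> borel_measurable lebesgue"
  by (rule Ap_weight_powr_measurable[OF Ap]) (use \<theta> \<eta> w0 in auto)

abbreviation bump_const :: real where
  "bump_const \<equiv> 4 powr (\<theta> * \<delta>) * enn2real (Ap_const s (\<lambda>x. w x powr (\<eta> * \<theta>))) powr (1 / \<eta>)"

lemma bump:
  assumes \<rho>: "0 \<le> \<rho>" "\<rho> * nb < \<delta>" and um: "u \<in> borel_measurable lebesgue"
    and u: "\<And>Q. Q \<in> cubes \<Longrightarrow> \<exists>c. \<forall>x. \<bar>u x - c\<bar> \<le> \<rho> * norm (b x - avg Q b)"
  shows "Ap_weight s (\<lambda>x. (w x * exp (u x)) powr \<theta>)" (is "Ap_weight s ?v")
    and "1 \<le> enn2real (Ap_const s (\<lambda>x. (w x * exp (u x)) powr \<theta>))"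
    and "enn2real (Ap_const s (\<lambda>x. (w x * exp (u x)) powr \<theta>)) \<le> bump_const"
proof -
  \<comment> \<open>\<open>Ap_perturb\<close> needs some \<open>N\<close> strictly above the norm;
    the strict inequality \<rho> * nb < \<delta> leaves room for \<delta> / \<rho>.\<close>
  obtain N where N: "nb < N" "\<rho> * N \<le> \<delta>"
  proof (cases "\<rho> = 0")
    case True
    then show ?thesis using that[of "nb + 1"] \<delta>0 by simp
  next
    case False
    then show ?thesis using that[of "\<delta> / \<rho>"] \<rho> by (simp add: field_simps)
  qed
  have N0: "0 < N" "BMO_norm b < ennreal N"
    using nb N by (auto simp: ennreal_less_iff)
  note pert = Ap_perturb[OF s \<theta> \<eta> w0 wm Ap bm N0 \<delta> N(2) um u]
  show v: "Ap_weight s ?v" by (rule pert(1))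
  have fin: "Ap_const s ?v < top" using v by (simp add: Ap_weight_def)
  then show "1 \<le> enn2real (Ap_const s ?v)"
    using enn2real_mono[OF Ap_const_ge_1[OF s v]] by simp
  have "Ap_const s (\<lambda>x. w x powr (\<eta> * \<theta>)) < top" using Ap by (simp add: Ap_weight_def)
  then obtain a where a: "0 \<le> a" "Ap_const s (\<lambda>x. w x powr (\<eta> * \<theta>)) = ennreal a"
    by (cases "Ap_const s (\<lambda>x. w x powr (\<eta> * \<theta>))") auto
  have "Ap_const s ?v \<le> ennreal (4 powr (\<theta> * \<delta>) * a powr (1 / \<eta>))"
    using pert(2) unfolding a(2) by (simp add: ennpowr_ennreal a(1) ennreal_mult)
  then have "enn2real (Ap_const s ?v) \<le> 4 powr (\<theta> * \<delta>) * a powr (1 / \<eta>)"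
    by (intro enn2real_leI) auto
  then show "enn2real (Ap_const s ?v) \<le> bump_const" unfolding a(2) using a(1) by simp
qed

lemma osc_Re: "\<exists>c. \<forall>x. \<bar>Re (z * b x) - c\<bar> \<le> norm z * norm (b x - avg Q b)"
proof (intro exI[of _ "Re (z * avg Q b)"] allI)
  fix x
  have "Re (z * b x) - Re (z * avg Q b) = Re (z * (b x - avg Q b))" by (simp add: algebra_simps)
  then show "\<bar>Re (z * b x) - Re (z * avg Q b)\<bar> \<le> norm z * norm (b x - avg Q b)"
    using abs_Re_le_cmod[of "z * (b x - avg Q b)"] by (simp add: norm_mult)
qed

lemma osc_norm:
  assumes "0 \<le> R" shows "\<exists>c. \<forall>x. \<bar>- R * norm (b x) - c\<bar> \<le> R * norm (b x - avg Q b)"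
proof (intro exI[of _ "- R * norm (avg Q b)"] allI)
  fix x
  have "\<bar>- R * norm (b x) - - R * norm (avg Q b)\<bar> = R * \<bar>norm (b x) - norm (avg Q b)\<bar>"
    using assms by (simp add: abs_mult abs_minus_commute flip: right_diff_distrib)
  also have "\<dots> \<le> R * norm (b x - avg Q b)"
    using assms by (intro mult_left_mono norm_triangle_ineq3) auto
  finally show "\<bar>- R * norm (b x) - - R * norm (avg Q b)\<bar> \<le> R * norm (b x - avg Q b)" .
qed

text \<open>Choose \<open>R > r\<close> that is still admissible. Then |b|^i exp (r |b|) is at most
  a constant times exp (R |b|), so every b^i g lies in the space with weight w exp (- R |b|). The
  perturbed weight satisfies the A_s condition, hence that space is contained in
  \<open>D\<close>.\<close>

lemma mem_stable_part:
  assumes q: "0 < q"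
    and D: "\<And>v. (\<forall>x. 0 \<le> v x) \<Longrightarrow> Ap_weight s (\<lambda>x. v x powr \<theta>) \<Longrightarrow> Lp_space q (\<lambda>x. v x powr q) \<subseteq> D"
    and r: "0 \<le> r" "r * nb < \<delta>"
    and f: "f \<in> Lp_space q (\<lambda>x. w x powr q)"
    and g[measurable]: "g \<in> borel_measurable lebesgue"
    and le: "\<And>x. norm (g x) \<le> exp (r * norm (b x)) * norm (f x)"
  shows "g \<in> stable_part b D"
  unfolding stable_part_def
proof (intro CollectI allI)
  fix i
  have fm[measurable]: "f \<in> borel_measurable lebesgue" using f by (simp add: Lp_space_def)
  obtain R where R: "r < R" "R * nb < \<delta>"
  proof (cases "nb = 0")
    case True
    then show ?thesis using that[of "r + 1"] \<delta>0 by simp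
  next
    case False
    then have "nb > 0" using nb by simp
    then have "r < \<delta> / nb" using r by (simp add: field_simps)
    then obtain R where "r < R" "R < \<delta> / nb" using dense by blast
    then show ?thesis using that[of R] \<open>nb > 0\<close> by (simp add: field_simps)
  qed
  let ?u = "\<lambda>x. - R * norm (b x)"
  have "Lp_space q (\<lambda>x. (w x * exp (?u x)) powr q) \<subseteq> D"
    by (rule D, use w0 in simp, rule bump(1)[of R]) (use r R osc_norm[of R] in auto)
  moreover have "(\<lambda>x. b x ^ i * g x) \<in> Lp_space q (\<lambda>x. (w x * exp (?u x)) powr q)"
  proof -
    define c where "c = fact i / (R - r) ^ i"
    have c0: "0 \<le> c" using R by (simp add: c_def)
    have "Lp_norm q (\<lambda>x. (w x * exp (?u x)) powr q) (\<lambda>x. b x ^ i * g x)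
        \<le> Lp_norm q (\<lambda>x. w x powr q) (\<lambda>x. of_real c * f x)"
    proof (intro Lp_norm_mono AE_I2 q)
      fix x
      let ?a = "norm (b x)"
      have "?a ^ i \<le> c * exp ((R - r) * ?a)"
      proof -
        have "(R - r) ^ i * ?a ^ i \<le> fact i * exp ((R - r) * ?a)"
          using power_le_fact_exp[of "(R - r) * ?a" i] R by (simp add: power_mult_distrib)
        then show ?thesis
          using R unfolding c_def times_divide_eq_left by (subst pos_le_divide_eq) (auto simp: mult.commute)
      qed
      then have "?a ^ i * norm (g x) \<le> (c * exp ((R - r) * ?a)) * (exp (r * ?a) * norm (f x))"
        using c0 by (intro mult_mono le) auto
      also have "\<dots> = c * exp (R * ?a) * norm (f x)"
      proof -
        have "exp ((R - r) * ?a) * exp (r * ?a) = exp (R * ?a)"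
          by (simp add: algebra_simps flip: exp_add)
        then show ?thesis by (metis mult.assoc)
      qed
      finally have "norm (b x ^ i * g x) * (w x * exp (?u x)) \<le> c * exp (R * ?a) * norm (f x) * (w x * exp (?u x))"
        using w0[of x] unfolding norm_mult norm_power by (intro mult_right_mono) auto
      also have "\<dots> = norm (of_real c * f x) * w x"
        using c0 by (simp add: norm_mult exp_minus)
      finally have "(norm (b x ^ i * g x) * (w x * exp (?u x))) powr q \<le> (norm (of_real c * f x) * w x) powr q"
        using w0[of x] q by (intro powr_mono2) auto
      then show "norm (b x ^ i * g x) powr q * (w x * exp (?u x)) powr q
          \<le> norm (of_real c * f x) powr q * w x powr q"
        by (simp only: powr_mult)
    qed
    also have "\<dots> = ennreal (norm (of_real c :: complex)) * Lp_norm q (\<lambda>x. w x powr q) f"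
      by (rule Lp_norm_cmult[OF q]) auto
    also have "\<dots> < top" using f by (simp add: Lp_space_def ennreal_mult_less_top)
    finally show ?thesis by (simp add: Lp_space_def)
  qed
  ultimately show "(\<lambda>x. b x ^ i * g x) \<in> D" by blast
qed

text \<open>This is \<open>commutator_bound\<close> at radius \<delta> / N for every N > nb. The
  resulting bound is continuous in \<open>N\<close>, and its limit from the right produces the power
  of the BMO norm. \<open>A\<close> and \<open>W\<close> carry the contribution of the other
  slots.\<close>

lemma commutator_bound_Ap:
  fixes S :: "(real^'n \<Rightarrow> complex) \<Rightarrow> real^'n \<Rightarrow> complex" and A :: ennreal
    and D :: "(real^'n \<Rightarrow> complex) set"
  defines "E \<equiv> stable_part b D"
  assumes p: "1 \<le> p" and q: "0 < q"
    and \<phi>: "mono_on {1..} \<phi>"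
    and Dm: "D \<subseteq> borel_measurable lebesgue" and D0: "(\<lambda>_. 0) \<in> D"
    and Dlin: "\<forall>g\<in>D. \<forall>h\<in>D. \<forall>c. (\<lambda>x. c * g x + h x) \<in> D"
    and D: "\<And>v. (\<forall>x. 0 \<le> v x) \<Longrightarrow> Ap_weight s (\<lambda>x. v x powr \<theta>) \<Longrightarrow> Lp_space q (\<lambda>x. v x powr q) \<subseteq> D"
    and Wm: "W \<in> borel_measurable lebesgue" and W0: "\<And>x. 0 \<le> W x"
    and Sm: "\<And>g. g \<in> E \<Longrightarrow> S g \<in> borel_measurable lebesgue"
    and Slin: "\<And>c g h. g \<in> E \<Longrightarrow> h \<in> E \<Longrightarrow>
        AE x in lebesgue. S (\<lambda>y. c * g y + h y) x = c * S g x + S h x"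
    and A: "A < top"
    and bound: "\<And>v g. (\<forall>x. 0 \<le> v x) \<Longrightarrow> Ap_weight s (\<lambda>x. v x powr \<theta>) \<Longrightarrow> g \<in> E \<Longrightarrow>
        g \<in> Lp_space q (\<lambda>x. v x powr q) \<Longrightarrow>
        Lp_norm p (\<lambda>x. W x * v x powr p) (S g) \<le>
          A * (ennreal (\<phi> (enn2real (Ap_const s (\<lambda>x. v x powr \<theta>)))) * Lp_norm q (\<lambda>x. v x powr q) g)"
    and f: "f \<in> Lp_space q (\<lambda>x. w x powr q)"
  shows "Lp_norm p (\<lambda>x. W x * w x powr p) ((lin_commutator b ^^ \<alpha>) S f) \<le>
    A * (ennreal (fact \<alpha>) * (ennreal (1 / \<delta> ^ \<alpha>) * ennreal (\<phi> bump_const) * BMO_norm b ^ \<alpha> *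
      Lp_norm q (\<lambda>x. w x powr q) f))"
proof -
  define K where "K = A * ennreal (\<phi> bump_const)"
  define L where "L = Lp_norm q (\<lambda>x. w x powr q) f"
  have fm[measurable]: "f \<in> borel_measurable lebesgue" and L: "L < top"
    using f by (auto simp: Lp_space_def L_def)
  have K: "K < top" using A by (simp add: K_def ennreal_mult_less_top)
  have "K * L < top" using K L by (simp add: ennreal_mult_less_top)
  then obtain k where k: "0 \<le> k" "K * L = ennreal k" by (cases "K * L") auto
  have bnd: "Lp_norm p (\<lambda>x. W x * w x powr p) ((lin_commutator b ^^ \<alpha>) S f)
      \<le> ennreal (fact \<alpha> / (\<delta> / N) ^ \<alpha>) * (K * L)" if N: "nb < N" for N
  proof -
    \<comment> \<open>The midpoint gives a second radius \<open>R = \<delta> / N'\<close> above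
      \<open>r = \<delta> / N\<close> that is still admissible.\<close>
    define N' where "N' = (nb + N) / 2"
    have N': "0 < N'" "nb < N'" "N' < N" using N nb by (auto simp: N'_def)
    define r R where "r = \<delta> / N" and "R = \<delta> / N'"
    have rR: "0 < r" "r < R" using N' \<delta>0 N by (auto simp: r_def R_def field_simps)
    have Rnb: "R * nb < \<delta>" using N' \<delta>0 by (simp add: R_def field_simps)
    have "r * nb \<le> R * nb" using rR nb by (intro mult_right_mono) auto
    then have rnb: "r * nb < \<delta>" using Rnb by simp
    have E: "g \<in> E" if "g \<in> borel_measurable lebesgue"
        "\<And>x. norm (g x) \<le> exp (r * norm (b x)) * norm (f x)" for g
      unfolding E_def by (rule mem_stable_part[OF q D _ rnb f that]) (use rR in auto)
    show ?thesis unfolding r_def[symmetric] L_def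
    proof (rule commutator_bound[where E = E and R = R, OF p q rR bm wm w0 Wm W0])
      show "E \<subseteq> borel_measurable lebesgue" using stable_part_subset Dm unfolding E_def by fast
      show "(\<lambda>_. 0) \<in> E" unfolding E_def by (rule stable_part_0[OF D0])
      show "(\<lambda>x. c * g x + h x) \<in> E" if "g \<in> E" "h \<in> E" for c g h
        using that unfolding E_def by (rule stable_part_lin[OF Dlin])
      show "(\<lambda>x. b x * g x) \<in> E" if "g \<in> E" for g
        using that unfolding E_def by (rule stable_part_mult)
      show "f \<in> E"
      proof (rule E)
        show "norm (f x) \<le> exp (r * norm (b x)) * norm (f x)" for x
          using mult_right_mono[of 1 "exp (r * norm (b x))" "norm (f x)"] rR by simp
      qed measurable
      show "Lp_norm q (\<lambda>x. w x powr q) f < top" using L by (simp add: L_def)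
      show "(\<lambda>x. exp (z * b x) * f x) \<in> E" if z: "norm z = r" for z
      proof (rule E)
        fix x
        have "Re (z * b x) \<le> r * norm (b x)"
          using complex_Re_le_cmod[of "z * b x"] z by (simp add: norm_mult)
        then show "norm (exp (z * b x) * f x) \<le> exp (r * norm (b x)) * norm (f x)"
          by (simp add: norm_mult mult_right_mono)
      qed measurable
      show "K < top" by (rule K)
      fix u g
      assume u: "u = (\<lambda>x. - R * norm (b x)) \<or> (\<exists>z. norm z = r \<and> u = (\<lambda>x. Re (z * b x)))"
        and g: "g \<in> E" "Lp_norm q (\<lambda>x. (w x * exp (u x)) powr q) g < top"
      have um[measurable]: "u \<in> borel_measurable lebesgue" using u by auto
      have "\<exists>c. \<forall>x. \<bar>u x - c\<bar> \<le> R * norm (b x - avg Q b)" for Q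
        using u
      proof (elim disjE exE conjE)
        fix z assume z: "norm z = r" "u = (\<lambda>x. Re (z * b x))"
        obtain c where c: "\<And>x. \<bar>u x - c\<bar> \<le> r * norm (b x - avg Q b)"
          using osc_Re[of z Q] unfolding z(1) z(2) by blast
        have "r * norm (b x - avg Q b) \<le> R * norm (b x - avg Q b)" for x
          using rR by (intro mult_right_mono) auto
        with c show ?thesis by (meson order_trans)
      qed (use osc_norm[of R Q] rR in auto)
      note bu = bump[OF less_imp_le[OF order.strict_trans[OF rR]] Rnb um this]
      have "g \<in> borel_measurable lebesgue" using g(1) stable_part_subset Dm unfolding E_def by fast
      then have "Lp_norm p (\<lambda>x. W x * (w x * exp (u x)) powr p) (S g) \<le>
          A * (ennreal (\<phi> (enn2real (Ap_const s (\<lambda>x. (w x * exp (u x)) powr \<theta>))))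
             * Lp_norm q (\<lambda>x. (w x * exp (u x)) powr q) g)"
        using g w0 by (intro bound bu(1)) (auto simp: Lp_space_def)
      also have "\<dots> \<le> A * (ennreal (\<phi> bump_const) * Lp_norm q (\<lambda>x. (w x * exp (u x)) powr q) g)"
        using bu(2,3) by (intro mult_left_mono mult_right_mono ennreal_leI mono_onD[OF \<phi>]) auto
      finally show "Lp_norm p (\<lambda>x. W x * (w x * exp (u x)) powr p) (S g)
          \<le> K * Lp_norm q (\<lambda>x. (w x * exp (u x)) powr q) g"
        by (simp add: K_def mult.assoc)
    qed (use Sm Slin in auto)
  qed
  have "Lp_norm p (\<lambda>x. W x * w x powr p) ((lin_commutator b ^^ \<alpha>) S f)
      \<le> ennreal (fact \<alpha> * nb ^ \<alpha> / \<delta> ^ \<alpha> * k)"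
  proof (rule tendsto_lowerbound[of _ _ "at_right nb"])
    show "((\<lambda>N. ennreal (fact \<alpha> * N ^ \<alpha> / \<delta> ^ \<alpha> * k)) \<longlongrightarrow> ennreal (fact \<alpha> * nb ^ \<alpha> / \<delta> ^ \<alpha> * k)) (at_right nb)"
      using \<delta>0 by (intro tendsto_ennrealI tendsto_intros) auto
    have "Lp_norm p (\<lambda>x. W x * w x powr p) ((lin_commutator b ^^ \<alpha>) S f)
      \<le> ennreal (fact \<alpha> * N ^ \<alpha> / \<delta> ^ \<alpha> * k)" if "nb < N" for N
      using bnd[OF that] that nb \<delta>0 k unfolding k(2) 
      by (simp add: power_divide flip: ennreal_mult)
    then show "\<forall>\<^sub>F N in at_right nb. Lp_norm p (\<lambda>x. W x * w x powr p) ((lin_commutator b ^^ \<alpha>) S f)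
      \<le> ennreal (fact \<alpha> * N ^ \<alpha> / \<delta> ^ \<alpha> * k)"
      by (simp add: eventually_at_filter)
  qed simp
  also have "\<dots> = (ennreal (fact \<alpha>) * ennreal (1 / \<delta> ^ \<alpha>) * ennreal nb ^ \<alpha>) * (K * L)"
    using nb \<delta>0 k by (simp add: ennreal_power flip: ennreal_mult)
  also have "\<dots> = A * (ennreal (fact \<alpha>) * (ennreal (1 / \<delta> ^ \<alpha>) * ennreal (\<phi> bump_const) * BMO_norm b ^ \<alpha> * L))"
    unfolding K_def nb(2) by (simp only: mult_ac)
  finally show ?thesis unfolding L_def .
qed

end

section \<open>Multilinearity of commutators and the induction over slots\<close>

lemma multilinear_operator_commutator:
  assumes T: "multilinear_operator m E T" and j: "j \<in> {1..m}"
    and b[measurable]: "b j \<in> borel_measurable lebesgue"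
    and Eb: "\<And>g. g \<in> E j \<Longrightarrow> (\<lambda>x. b j x * g x) \<in> E j"
  shows "multilinear_operator m E (commutator b j T)"
proof -
  have upd: "f(j := (\<lambda>y. b j y * f j y)) \<in> (\<Pi>\<^sub>E j\<in>{1..m}. E j)" if "f \<in> (\<Pi>\<^sub>E j\<in>{1..m}. E j)" for f
    using that j Eb by (intro PiE_I) (auto simp: PiE_iff extensional_def)
  have Tm: "T f \<in> borel_measurable lebesgue" if "f \<in> (\<Pi>\<^sub>E j\<in>{1..m}. E j)" for f
    using T that by (simp add: multilinear_operator_def)
  have Tlin: "AE x in lebesgue. T (f(i := (\<lambda>y. c * g y + h y))) x = c * T (f(i := g)) x + T (f(i := h)) x"
    if "f \<in> (\<Pi>\<^sub>E j\<in>{1..m}. E j)" "i \<in> {1..m}" "g \<in> E i" "h \<in> E i" for f i g h c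
    using T that by (simp add: multilinear_operator_def)
  show ?thesis
    unfolding multilinear_operator_def
  proof (intro conjI)
    show "\<forall>j\<in>{1..m}. E j \<subseteq> borel_measurable lebesgue \<and> (\<lambda>_. 0) \<in> E j \<and>
       (\<forall>g\<in>E j. \<forall>h\<in>E j. \<forall>c. (\<lambda>x. c * g x + h x) \<in> E j)"
      using T by (simp add: multilinear_operator_def)
    show "\<forall>f\<in>(\<Pi>\<^sub>E j\<in>{1..m}. E j). commutator b j T f \<in> borel_measurable lebesgue \<and>
       (\<forall>i\<in>{1..m}. \<forall>g\<in>E i. \<forall>h\<in>E i. \<forall>c. AE x in lebesgue.
          commutator b j T (f(i := (\<lambda>y. c * g y + h y))) x
          = c * commutator b j T (f(i := g)) x + commutator b j T (f(i := h)) x)"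
    proof (intro ballI allI conjI)
      fix f assume f: "f \<in> (\<Pi>\<^sub>E j\<in>{1..m}. E j)"
      have [measurable]: "T f \<in> borel_measurable lebesgue"
          "T (f(j := (\<lambda>y. b j y * f j y))) \<in> borel_measurable lebesgue"
        using Tm f upd by blast+
      show "commutator b j T f \<in> borel_measurable lebesgue"
        unfolding commutator_def by measurable
      fix i g h c assume i: "i \<in> {1..m}" and g: "g \<in> E i" and h: "h \<in> E i"
      note 1 = Tlin[OF f i g h, of c]
      show "AE x in lebesgue. commutator b j T (f(i := (\<lambda>y. c * g y + h y))) x
          = c * commutator b j T (f(i := g)) x + commutator b j T (f(i := h)) x"
      \<comment> \<open>In slot \<open>j\<close> itself, multiplication by \<open>b j\<close>
        respects linear combinations; in any other slot the two updates commute.\<close>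
      proof (cases "i = j")
        case True
        have eq: "(\<lambda>y. b j y * (c * g y + h y)) = (\<lambda>y. c * (b j y * g y) + b j y * h y)"
          by (simp add: algebra_simps)
        have "AE x in lebesgue. T (f(j := (\<lambda>y. c * (b j y * g y) + b j y * h y))) x
            = c * T (f(j := (\<lambda>y. b j y * g y))) x + T (f(j := (\<lambda>y. b j y * h y))) x"
          using g h True by (intro Tlin f j Eb) auto
        with 1 show ?thesis
          unfolding commutator_def True by eventually_elim (simp add: eq algebra_simps)
      next
        case False
        let ?f = "f(j := (\<lambda>y. b j y * f j y))"
        have sw: "(f(i := k))(j := (\<lambda>y. b j y * (f(i := k)) j y)) = ?f(i := k)" for k
          using False by (simp add: fun_upd_twist)
        show ?thesis
          using 1 Tlin[OF upd[OF f] i g h, of c]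
          unfolding commutator_def sw by eventually_elim (simp add: algebra_simps)
      qed
    qed
  qed
qed

lemma multilinear_operator_commutator_iterate:
  assumes "multilinear_operator m E T" "j \<in> {1..m}" "b j \<in> borel_measurable lebesgue"
    and "\<And>g. g \<in> E j \<Longrightarrow> (\<lambda>x. b j x * g x) \<in> E j"
  shows "multilinear_operator m E ((commutator b j ^^ k) T)"
  by (induction k) (use assms in \<open>auto intro: multilinear_operator_commutator\<close>)

text \<open>A commutator in slot \<open>j\<close> leaves the other entries alone, so with these
  frozen its iterates are those of a linear operator in one variable.\<close>

lemma commutator_iterate_slot:
  "(\<lambda>g. (commutator b j ^^ k) T (f(j := g))) = (lin_commutator (b j) ^^ k) (\<lambda>g. T (f(j := g)))"
proof (induction k)
  case (Suc k)
  show ?case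
    unfolding funpow.simps o_apply Suc.IH[symmetric]
    by (simp only: commutator_def lin_commutator_def fun_upd_same fun_upd_upd)
qed simp

lemma ennreal_prod_less_top:
  fixes a :: "'i \<Rightarrow> ennreal"
  assumes "\<And>i. i \<in> I \<Longrightarrow> a i < top" shows "prod a I < top"
  using assms by (induction I rule: infinite_finite_induct) (auto simp: ennreal_mult_less_top)

text \<open>The last slot is the outermost commutator, which allows induction on the number of slots
  treated.\<close>

lemma multi_commutator_Suc:
  "multi_commutator (Suc k) b \<alpha> T = (commutator b (Suc k) ^^ \<alpha> (Suc k)) (multi_commutator k b \<alpha> T)"
  by (simp add: multi_commutator_def)

theorem theorem4p3:
  fixes T :: "(nat \<Rightarrow> real ^ 'n \<Rightarrow> complex) \<Rightarrow> real ^ 'n \<Rightarrow> complex"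
    and D :: "nat \<Rightarrow> (real ^ 'n \<Rightarrow> complex) set"
    and m :: nat
    and p :: real
    and pp s \<theta> :: "nat \<Rightarrow> real"
    and \<phi> :: "nat \<Rightarrow> real \<Rightarrow> real"
    and b :: "nat \<Rightarrow> real ^ 'n \<Rightarrow> complex"
    and \<alpha> :: "nat \<Rightarrow> nat"
    and w :: "nat \<Rightarrow> real ^ 'n \<Rightarrow> real"
    and \<eta> \<delta> :: "nat \<Rightarrow> real"
    and f :: "nat \<Rightarrow> real ^ 'n \<Rightarrow> complex"
  assumes "1 \<le> m"
    and "multilinear_operator m D T"
    and "\<And>j. j \<in> {1..m} \<Longrightarrow> 1 < pp j"
    and "\<And>j. j \<in> {1..m} \<Longrightarrow> 1 < s j"
    and "\<And>j. j \<in> {1..m} \<Longrightarrow> 0 < \<theta> j"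
    and "1 < p"
    and "1 / p = (\<Sum>j = 1..m. 1 / pp j)"
    and "\<And>j. j \<in> {1..m} \<Longrightarrow> mono_on {1..} (\<phi> j)"
    and "\<And>j t. j \<in> {1..m} \<Longrightarrow> 1 \<le> t \<Longrightarrow> 0 \<le> \<phi> j t"
    \<comment> \<open>the spaces in the a priori estimate below lie in the domain of \<open>T\<close>\<close>
    and "\<And>j v. j \<in> {1..m} \<Longrightarrow> (\<forall>x. 0 \<le> v x) \<Longrightarrow> Ap_weight (s j) (\<lambda>x. v x powr \<theta> j) \<Longrightarrow>
           Lp_space (pp j) (\<lambda>x. v x powr pp j) \<subseteq> D j"
    and "\<And>v g.
           (\<forall>j\<in>{1..m}. (\<forall>x. 0 \<le> v j x) \<and> Ap_weight (s j) (\<lambda>x. v j x powr \<theta> j)) \<Longrightarrow>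
           g \<in> (\<Pi>\<^sub>E j\<in>{1..m}. Lp_space (pp j) (\<lambda>x. v j x powr pp j)) \<Longrightarrow>
           Lp_norm p (\<lambda>x. \<Prod>j = 1..m. v j x powr p) (T g) \<le>
             (\<Prod>j = 1..m.
                ennreal (\<phi> j (enn2real (Ap_const (s j) (\<lambda>x. v j x powr \<theta> j)))) *
                Lp_norm (pp j) (\<lambda>x. v j x powr pp j) (g j))"
    and "\<And>j. j \<in> {1..m} \<Longrightarrow> b j \<in> BMO"
    and "\<And>j. j \<in> {1..m} \<Longrightarrow> 1 < \<eta> j"
    and "\<And>j x. j \<in> {1..m} \<Longrightarrow> 0 \<le> w j x"
    and "\<And>j. j \<in> {1..m} \<Longrightarrow> Ap_weight (s j) (\<lambda>x. w j x powr (\<eta> j * \<theta> j))"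
    and "\<And>j. j \<in> {1..m} \<Longrightarrow> \<delta> j = min 1 (s j - 1) / (conj_exp (\<eta> j) * \<theta> j)"
    and "f \<in> (\<Pi>\<^sub>E j\<in>{1..m}. Lp_space (pp j) (\<lambda>x. w j x powr pp j))"
  shows "Lp_norm p (\<lambda>x. \<Prod>j = 1..m. w j x powr p) (multi_commutator m b \<alpha> T f) \<le>
           ennreal (\<Prod>j = 1..m. fact (\<alpha> j)) *
           (\<Prod>j = 1..m.
              ennreal (1 / \<delta> j ^ \<alpha> j) *
              ennreal (\<phi> j (4 powr (\<theta> j * \<delta> j) *
                 enn2real (Ap_const (s j) (\<lambda>x. w j x powr (\<eta> j * \<theta> j))) powr (1 / \<eta> j))) *
              BMO_norm (b j) ^ \<alpha> j *
              Lp_norm (pp j) (\<lambda>x. w j x powr pp j) (f j))"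
proof -
  note assm = assms
  define E where "E = (\<lambda>j. stable_part (b j) (D j))"
  \<comment> \<open>\<open>F\<close> is the final factor of a slot already treated, at the fixed
    weight \<open>w j\<close>; \<open>G\<close> is the factor from the a priori estimate for a slot
    not yet treated, at an arbitrary weight.\<close>
  define F where "F = (\<lambda>j h. ennreal (fact (\<alpha> j)) * (ennreal (1 / \<delta> j ^ \<alpha> j) *
              ennreal (\<phi> j (4 powr (\<theta> j * \<delta> j) *
                 enn2real (Ap_const (s j) (\<lambda>x. w j x powr (\<eta> j * \<theta> j))) powr (1 / \<eta> j))) *
              BMO_norm (b j) ^ \<alpha> j *
              Lp_norm (pp j) (\<lambda>x. w j x powr pp j) h))"
  define G where "G = (\<lambda>j (v :: real^'n \<Rightarrow> real) h. ennreal (\<phi> j (enn2real (Ap_const (s j) (\<lambda>x. v x powr \<theta> j)))) *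
              Lp_norm (pp j) (\<lambda>x. v x powr pp j) h)"
  define nb where "nb = (\<lambda>j. enn2real (BMO_norm (b j)))"
  have bump: "Ap_bump (s j) (\<theta> j) (\<eta> j) (\<delta> j) (nb j) (w j) (b j)" if j: "j \<in> {1..m}" for j
  proof
    show "BMO_norm (b j) = ennreal (nb j)" using assms(12)[OF j] by (simp add: nb_def BMO_def)
  qed (use assms j in \<open>auto simp: nb_def\<close>)
  have q: "0 < pp j" if "j \<in> {1..m}" for j using assms(3)[OF that] by simp
  have Dj: "D j \<subseteq> borel_measurable lebesgue" "(\<lambda>_. 0) \<in> D j"
      "\<forall>g\<in>D j. \<forall>h\<in>D j. \<forall>c. (\<lambda>x. c * g x + h x) \<in> D j" if "j \<in> {1..m}" for j
    using assms(2) that by (auto simp: multilinear_operator_def)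
  \<comment> \<open>The trivial perturbation u = 0 with radius 0 lowers the power of the weight from
    \<eta> \<theta> to \<theta>.\<close>
  have wAp: "Ap_weight (s j) (\<lambda>x. w j x powr \<theta> j)" if j: "j \<in> {1..m}" for j
  proof -
    interpret Ap_bump "s j" "\<theta> j" "\<eta> j" "\<delta> j" "nb j" "w j" "b j" by (rule bump[OF j])
    show ?thesis using bump(1)[of 0 "\<lambda>_. 0"] \<delta>0 by auto
  qed
  have wE: "h \<in> E j" if j: "j \<in> {1..m}" and h: "h \<in> Lp_space (pp j) (\<lambda>x. w j x powr pp j)" for j h
  proof -
    interpret Ap_bump "s j" "\<theta> j" "\<eta> j" "\<delta> j" "nb j" "w j" "b j" by (rule bump[OF j])
    show ?thesis unfolding E_def
      by (rule mem_stable_part[where r = 0, OF q[OF j] assms(10)[OF j] _ _ h])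
         (use h \<delta>0 in \<open>auto simp: Lp_space_def\<close>)
  qed
  have ED: "E j \<subseteq> D j" for j unfolding E_def by (rule stable_part_subset)
  have TE: "multilinear_operator m E T"
    unfolding multilinear_operator_def
  proof (intro conjI ballI allI)
    fix j assume j: "j \<in> {1..m}"
    show "E j \<subseteq> borel_measurable lebesgue" using ED[of j] Dj(1)[OF j] by blast
    show "(\<lambda>_. 0) \<in> E j" unfolding E_def by (rule stable_part_0[OF Dj(2)[OF j]])
    show "(\<lambda>x. c * g x + h x) \<in> E j" if "g \<in> E j" "h \<in> E j" for g h c
      using that unfolding E_def by (rule stable_part_lin[OF Dj(3)[OF j]])
  next
    fix g assume "g \<in> (\<Pi>\<^sub>E j\<in>{1..m}. E j)"
    then have g: "g \<in> (\<Pi>\<^sub>E j\<in>{1..m}. D j)" using ED by (auto simp: PiE_iff)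
    then show "T g \<in> borel_measurable lebesgue"
      using assms(2) by (simp add: multilinear_operator_def)
    show "AE x in lebesgue. T (g(i := (\<lambda>y. c * k y + h y))) x = c * T (g(i := k)) x + T (g(i := h)) x"
      if "i \<in> {1..m}" "k \<in> E i" "h \<in> E i" for i k h c
    proof -
      have "k \<in> D i" "h \<in> D i" using that ED by blast+
      then show ?thesis using assms(2) g that(1) unfolding multilinear_operator_def by simp
    qed
  qed
  \<comment> \<open>Weights of untreated slots stay arbitrary because the next slot needs the
    estimate for its perturbed weights. Treated slots are fixed at \<open>w\<close>, the weights for
    which their final factors are established.\<close>
  have step: "multilinear_operator m E (multi_commutator k b \<alpha> T) \<and>
    (\<forall>v g. (\<forall>j\<in>{1..m}. (\<forall>x. 0 \<le> v j x) \<and> Ap_weight (s j) (\<lambda>x. v j x powr \<theta> j)) \<longrightarrow>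
      (\<forall>j\<in>{1..k}. v j = w j) \<longrightarrow>
      g \<in> (\<Pi>\<^sub>E j\<in>{1..m}. E j \<inter> Lp_space (pp j) (\<lambda>x. v j x powr pp j)) \<longrightarrow>
      Lp_norm p (\<lambda>x. \<Prod>j = 1..m. v j x powr p) (multi_commutator k b \<alpha> T g)
        \<le> (\<Prod>j = 1..m. if j \<le> k then F j (g j) else G j (v j) (g j)))" if "k \<le> m" for k
    using that
  proof (induction k)
    case 0
    have "Lp_norm p (\<lambda>x. \<Prod>j = 1..m. v j x powr p) (T g) \<le> (\<Prod>j = 1..m. G j (v j) (g j))"
      if "\<forall>j\<in>{1..m}. (\<forall>x. 0 \<le> v j x) \<and> Ap_weight (s j) (\<lambda>x. v j x powr \<theta> j)"
        "g \<in> (\<Pi>\<^sub>E j\<in>{1..m}. E j \<inter> Lp_space (pp j) (\<lambda>x. v j x powr pp j))" for v g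
      unfolding G_def using that by (intro assm(11)) (auto simp: PiE_iff)
    moreover have "(\<Prod>j = 1..m. if j \<le> 0 then F j (g j) else G j (v j) (g j)) = (\<Prod>j = 1..m. G j (v j) (g j))"
      for v g by (intro prod.cong) auto
    ultimately show ?case using TE by (simp add: multi_commutator_def)
  next
    case (Suc k)
    define U where "U = multi_commutator k b \<alpha> T"
    let ?j = "Suc k" and ?I = "{1..m} - {Suc k}"
    have j: "?j \<in> {1..m}" using Suc.prems by simp
    interpret Ap_bump "s ?j" "\<theta> ?j" "\<eta> ?j" "\<delta> ?j" "nb ?j" "w ?j" "b ?j" by (rule bump[OF j])
    have U: "multilinear_operator m E U" using Suc by (simp add: U_def)
    have IH: "Lp_norm p (\<lambda>x. \<Prod>j = 1..m. v j x powr p) (U g)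
        \<le> (\<Prod>j = 1..m. if j \<le> k then F j (g j) else G j (v j) (g j))"
      if "\<And>j x. j \<in> {1..m} \<Longrightarrow> 0 \<le> v j x" "\<And>j. j \<in> {1..m} \<Longrightarrow> Ap_weight (s j) (\<lambda>x. v j x powr \<theta> j)"
        "\<And>j. j \<in> {1..k} \<Longrightarrow> v j = w j"
        "g \<in> (\<Pi>\<^sub>E j\<in>{1..m}. E j \<inter> Lp_space (pp j) (\<lambda>x. v j x powr pp j))" for v g
      using Suc.IH Suc.prems that unfolding U_def by simp
    have split: "prod a {1..m} = prod a ?I * a ?j" for a :: "nat \<Rightarrow> 'c :: comm_monoid_mult"
      using prod.remove[of "{1..m}" ?j a] j by (simp add: mult.commute)
    show ?case
      unfolding multi_commutator_Suc U_def[symmetric]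
    proof (intro conjI allI impI)
      show "multilinear_operator m E ((commutator b ?j ^^ \<alpha> ?j) U)"
        by (rule multilinear_operator_commutator_iterate[where b = b, OF U j bm])
           (simp add: E_def stable_part_mult)
      fix v g
      assume v: "\<forall>j\<in>{1..m}. (\<forall>x. 0 \<le> v j x) \<and> Ap_weight (s j) (\<lambda>x. v j x powr \<theta> j)"
        and vw: "\<forall>j\<in>{1..Suc k}. v j = w j"
        and g: "g \<in> (\<Pi>\<^sub>E j\<in>{1..m}. E j \<inter> Lp_space (pp j) (\<lambda>x. v j x powr pp j))"
      \<comment> \<open>With all entries but that of slot \<open>Suc k\<close> frozen,
        \<open>S\<close> is a linear operator, \<open>W\<close> collects the other weights and
        \<open>A\<close> the other factors. \<open>A\<close> must be finite because the limits in
        the one-slot bound are taken over real numbers.\<close>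
      define S where "S = (\<lambda>h. U (g(?j := h)))"
      define W where "W = (\<lambda>x. \<Prod>i\<in>?I. v i x powr p)"
      define A where "A = (\<Prod>i\<in>?I. if i \<le> k then F i (g i) else G i (v i) (g i))"
      have vm: "v i \<in> borel_measurable lebesgue" if "i \<in> {1..m}" for i
        by (rule Ap_weight_powr_measurable[where a = "\<theta> i"])
           (use v that assms(5)[OF that] in auto)
      have gE: "g \<in> (\<Pi>\<^sub>E j\<in>{1..m}. E j)" using g by (auto simp: PiE_iff)
      have updE: "g(?j := h) \<in> (\<Pi>\<^sub>E j\<in>{1..m}. E j)" if "h \<in> E ?j" for h
        using gE j that by (intro PiE_I) (auto simp: PiE_iff extensional_def)
      have Lfin: "Lp_norm (pp i) (\<lambda>x. v i x powr pp i) (g i) < top" if "i \<in> {1..m}" for i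
        using g that by (auto simp: PiE_iff Lp_space_def)
      have A: "A < top" unfolding A_def
      proof (rule ennreal_prod_less_top)
        fix i assume i: "i \<in> ?I"
        then have im: "i \<in> {1..m}" by simp
        have "BMO_norm (b i) < top" using assms(12)[OF im] by (simp add: BMO_def)
        moreover have "F i (g i) < top" if "i \<le> k"
        proof -
          have "v i = w i" using vw i that by simp
          then show ?thesis using Lfin[OF im] \<open>BMO_norm (b i) < top\<close>
            by (simp add: F_def ennreal_mult_less_top power_less_top_ennreal)
        qed
        moreover have "G i (v i) (g i) < top"
          using Lfin[OF im] by (simp add: G_def ennreal_mult_less_top)
        ultimately show "(if i \<le> k then F i (g i) else G i (v i) (g i)) < top" by simp
      qed
      have bound: "Lp_norm p (\<lambda>x. W x * v' x powr p) (S h) \<le> A * G ?j v' h"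
        if v': "\<forall>x. 0 \<le> v' x" "Ap_weight (s ?j) (\<lambda>x. v' x powr \<theta> ?j)" and h: "h \<in> E ?j"
          "h \<in> Lp_space (pp ?j) (\<lambda>x. v' x powr pp ?j)" for v' h
      proof -
        let ?v = "v(?j := v')" and ?g = "g(?j := h)"
        have "Lp_norm p (\<lambda>x. \<Prod>j = 1..m. ?v j x powr p) (U ?g)
            \<le> (\<Prod>j = 1..m. if j \<le> k then F j (?g j) else G j (?v j) (?g j))"
        proof (rule IH)
          show "?g \<in> (\<Pi>\<^sub>E j\<in>{1..m}. E j \<inter> Lp_space (pp j) (\<lambda>x. ?v j x powr pp j))"
            using g h j by (intro PiE_I) (auto simp: PiE_iff extensional_def)
        qed (use v v' vw in auto)
        also have "(\<Prod>j = 1..m. if j \<le> k then F j (?g j) else G j (?v j) (?g j)) = A * G ?j v' h"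
          unfolding split A_def by (intro arg_cong2[where f = "(*)"] prod.cong) auto
        also have "(\<lambda>x. \<Prod>j = 1..m. ?v j x powr p) = (\<lambda>x. W x * v' x powr p)"
          unfolding split W_def by (intro ext arg_cong2[where f = "(*)"] prod.cong) auto
        finally show ?thesis unfolding S_def .
      qed
      have gj: "g ?j \<in> Lp_space (pp ?j) (\<lambda>x. w ?j x powr pp ?j)"
      proof -
        have "v ?j = w ?j" using vw by simp
        moreover have "g ?j \<in> Lp_space (pp ?j) (\<lambda>x. v ?j x powr pp ?j)"
          using PiE_mem[OF g j] by simp
        ultimately show ?thesis by simp
      qed
      have "Lp_norm p (\<lambda>x. W x * w ?j x powr p) ((lin_commutator (b ?j) ^^ \<alpha> ?j) S (g ?j)) \<le> A * F ?j (g ?j)"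
        unfolding F_def
      proof (rule commutator_bound_Ap[where D = "D ?j"])
        show "1 \<le> p" using assms(6) by simp
        show "W \<in> borel_measurable lebesgue"
          unfolding W_def
        proof (rule borel_measurable_prod)
          fix i assume "i \<in> ?I"
          then have [measurable]: "v i \<in> borel_measurable lebesgue" using vm by simp
          show "(\<lambda>x. v i x powr p) \<in> borel_measurable lebesgue" by measurable
        qed
        show "0 \<le> W x" for x unfolding W_def by (intro prod_nonneg) auto
        show "S h \<in> borel_measurable lebesgue" if "h \<in> stable_part (b ?j) (D ?j)" for h
          using U updE[unfolded E_def, OF that] unfolding S_def multilinear_operator_def E_def by blast
        show "AE x in lebesgue. S (\<lambda>y. c * h y + h' y) x = c * S h x + S h' x"
          if "h \<in> stable_part (b ?j) (D ?j)" "h' \<in> stable_part (b ?j) (D ?j)" for c h h'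
          using U gE that j unfolding S_def multilinear_operator_def E_def by blast
        show "Lp_norm p (\<lambda>x. W x * v' x powr p) (S h) \<le>
          A * (ennreal (\<phi> ?j (enn2real (Ap_const (s ?j) (\<lambda>x. v' x powr \<theta> ?j)))) *
            Lp_norm (pp ?j) (\<lambda>x. v' x powr pp ?j) h)"
          if "\<forall>x. 0 \<le> v' x" "Ap_weight (s ?j) (\<lambda>x. v' x powr \<theta> ?j)" "h \<in> stable_part (b ?j) (D ?j)"
            "h \<in> Lp_space (pp ?j) (\<lambda>x. v' x powr pp ?j)" for v' h
          using bound that unfolding G_def E_def by blast
      qed (use j q Dj A gj assm(8,10) in \<open>blast+\<close>)
      moreover have "(lin_commutator (b ?j) ^^ \<alpha> ?j) S (g ?j) = (commutator b ?j ^^ \<alpha> ?j) U g"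
        unfolding S_def commutator_iterate_slot[symmetric] by simp
      moreover have "(\<lambda>x. W x * w ?j x powr p) = (\<lambda>x. \<Prod>j = 1..m. v j x powr p)"
        unfolding split W_def using vw by simp
      moreover have "A * F ?j (g ?j) = (\<Prod>j = 1..m. if j \<le> Suc k then F j (g j) else G j (v j) (g j))"
        unfolding split A_def by (intro arg_cong2[where f = "(*)"] prod.cong) auto
      ultimately show "Lp_norm p (\<lambda>x. \<Prod>j = 1..m. v j x powr p) ((commutator b ?j ^^ \<alpha> ?j) U g)
        \<le> (\<Prod>j = 1..m. if j \<le> Suc k then F j (g j) else G j (v j) (g j))"
        by simp
    qed
  qed
  have fE: "f \<in> (\<Pi>\<^sub>E j\<in>{1..m}. E j \<inter> Lp_space (pp j) (\<lambda>x. w j x powr pp j))"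
    using assms(17) wE by (auto simp: PiE_iff)
  have "Lp_norm p (\<lambda>x. \<Prod>j = 1..m. w j x powr p) (multi_commutator m b \<alpha> T f)
      \<le> (\<Prod>j = 1..m. if j \<le> m then F j (f j) else G j (w j) (f j))"
    by (rule step[OF order_refl, THEN conjunct2, rule_format]) (use assms(14) wAp fE in auto)
  also have "\<dots> = (\<Prod>j = 1..m. F j (f j))" by (intro prod.cong) auto
  finally show ?thesis
    unfolding F_def prod.distrib[of "\<lambda>j. ennreal (fact (\<alpha> j))"] by (subst (asm) prod_ennreal) auto
qed

end
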